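(* Let $F_1,\ldots,F_k:\mathbb{C}^n\to\mathbb{C}^n$ be polynomial maps (with coefficients in $\mathbb{Q}$), $F=(F_1,\ldots,F_k)$, and $\mathbf{a}\in\mathbb{Q}^n$. Let $\mathbf{h}=(h_1,\ldots,h_l)$ and $\boldsymbol{g}=(g_1,\ldots,g_m)$ be sequences of polynomials in $\mathbb{Q}[x_1,\ldots,x_n]$, and let $E$ be the vector space spanned by $\boldsymbol{g}$. Then there exists an algorithm, $\mathsf{TruncatedIdealBranch}$, that takes the input $(\mathbf{a},\boldsymbol{g},\mathbf{h},F)$ and outputs a sequence of polynomials that forms a vector basis for $I_{\mathcal{L}(\mathbf{a},\mathbf{h},F),E}$.
   Context: Notation: $\mathbf{x}=(x_1,\ldots,x_n)$, $[k]=\{1,\ldots,k\}$. For $i_1,\ldots,i_r\in[k]$, $F_{i_1,\ldots,i_r}=F_{i_r}\circ\cdots\circ F_{i_1}$, with the empty composition equal to the identity. Branching loop: $\mathcal{L}(\mathbf{a},\mathbf{h},(F_1,\ldots,F_k))$ is the loop which initializes $\mathbf{x}=\mathbf{a}$ and, while $h_1(\mathbf{x})\neq0,\ldots,h_l(\mathbf{x})\neq0$ (equivalently $h(\mathbf{x})\neq0$ with $h=h_1\cdots h_l$), nondeterministically chooses $i\in[k]$ and performs $\mathbf{x}\leftarrow F_i(\mathbf{x})$. A polynomial $g\in\mathbb{C}[\mathbf{x}]$ is a polynomial invariant of the loop if $g(\mathbf{a})=0$ and, for every $r\in\mathbb{N}$ and every $i_1,\ldots,i_r\in[k]$, either $g(F_{i_1}(\mathbf{a}))=\cdots=g(F_{i_1,\ldots,i_r}(\mathbf{a}))=0$,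 or there is $0\le l'<r$ such that $g(F_{i_1}(\mathbf{a}))=\cdots=g(F_{i_1,\ldots,i_{l'}}(\mathbf{a}))=0$ and $h(F_{i_1,\ldots,i_{l'}}(\mathbf{a}))=0$. $I_{\mathcal{L}(\mathbf{a},\mathbf{h},F),E}$ is the vector space of polynomial invariants of the loop lying in $E$. *)

theory Defs
  imports Complex_Main "HOL-Library.Poly_Mapping" "HOL-Library.Nat_Bijection"
begin

section \<open>Multivariate polynomials\<close>

text \<open>A polynomial maps exponent vectors to coefficients, both finitely supported; the variables are
  indexed from 0, so that \<open>x\<^sub>1, \<dots>, x\<^sub>n\<close> have the indices \<open>0, \<dots>, n - 1\<close>.\<close>

type_synonym 'a mpoly = "(nat \<Rightarrow>\<^sub>0 nat) \<Rightarrow>\<^sub>0 'a"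

definition vars :: "'a::zero mpoly \<Rightarrow> nat set" where
  "vars p = (\<Union>m\<in>Poly_Mapping.keys p. Poly_Mapping.keys m)"

definition polys_in :: "nat \<Rightarrow> 'a::zero mpoly set" where
  "polys_in n = {p. vars p \<subseteq> {..<n}}"

text \<open>Points are lists. Evaluating at a point \<open>x\<close> is only meaningful for \<open>p \<in> polys_in (length x)\<close>.\<close>

definition eval_poly :: "'a::comm_semiring_1 mpoly \<Rightarrow> 'a list \<Rightarrow> 'a" where
  "eval_poly p x = (\<Sum>m\<in>Poly_Mapping.keys p.
     Poly_Mapping.lookup p m * (\<Prod>i\<in>Poly_Mapping.keys m. x ! i ^ Poly_Mapping.lookup m i))"

definition complex_poly :: "rat mpoly \<Rightarrow> complex mpoly" where
  "complex_poly p = Poly_Mapping.map of_rat p"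

definition scale_poly :: "complex \<Rightarrow> complex mpoly \<Rightarrow> complex mpoly" where
  "scale_poly c p = Poly_Mapping.map (\<lambda>z. c * z) p"

lemma lookup_scale_poly [simp]:
  "Poly_Mapping.lookup (scale_poly c p) m = c * Poly_Mapping.lookup p m"
  by (simp add: scale_poly_def map.rep_eq when_def)

global_interpretation cpoly: vector_space scale_poly
  by unfold_locales (auto intro!: poly_mapping_eqI simp: lookup_add algebra_simps)

text \<open>Linear independence is a property of sets, hence the separate requirement \<open>distinct\<close> for a
  sequence.\<close>

definition is_vector_basis :: "complex mpoly list \<Rightarrow> complex mpoly set \<Rightarrow> bool" where
  "is_vector_basis bs V \<longleftrightarrow> distinct bs \<and> cpoly.independent (set bs) \<and> cpoly.span (set bs) = V"


section \<open>Branching loops and their polynomial invariants\<close>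

definition apply_map :: "'a::comm_semiring_1 mpoly list \<Rightarrow> 'a list \<Rightarrow> 'a list" where
  "apply_map f x = map (\<lambda>p. eval_poly p x) f"

text \<open>\<open>run F [i\<^sub>1, \<dots>, i\<^sub>r] = F\<^bsub>i\<^sub>r\<^esub> \<circ> \<dots> \<circ> F\<^bsub>i\<^sub>1\<^esub>\<close>: the head of the list is applied first. The maps
  are indexed from 0.\<close>

definition run :: "'a::comm_semiring_1 mpoly list list \<Rightarrow> nat list \<Rightarrow> 'a list \<Rightarrow> 'a list" where
  "run F is x = fold (\<lambda>i. apply_map (F ! i)) is x"

text \<open>Here \<open>n\<close> is the dimension \<open>length a\<close>. In the formula, \<open>take j is\<close> is \<open>[i\<^sub>1, \<dots>, i\<^sub>j]\<close>, and
  \<open>prod_list h\<close> is the product of all guard polynomials (1 if there are none).\<close>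

definition loop_invariant ::
  "complex list \<Rightarrow> complex mpoly list \<Rightarrow> complex mpoly list list \<Rightarrow> complex mpoly \<Rightarrow> bool" where
  "loop_invariant a h F g \<longleftrightarrow>
     g \<in> polys_in (length a) \<and> eval_poly g a = 0 \<and>
     (\<forall>is. set is \<subseteq> {..<length F} \<longrightarrow>
        (\<forall>j\<in>{1..length is}. eval_poly g (run F (take j is) a) = 0) \<or>
        (\<exists>l'<length is. (\<forall>j\<in>{1..l'}. eval_poly g (run F (take j is) a) = 0) \<and>
           eval_poly (prod_list h) (run F (take l' is) a) = 0))"

definition truncated_ideal ::
  "complex list \<Rightarrow> complex mpoly list \<Rightarrow> complex mpoly list list \<Rightarrow> complex mpoly set
     \<Rightarrow> complex mpoly set" where
  "truncated_ideal a h F E = {g \<in> E. loop_invariant a h F g}"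


section \<open>Algorithms\<close>

text \<open>Algorithms are partial recursive functions. A description \<open>f\<close> denotes the partial function
  whose graph is \<open>rec_eval f\<close>; the absence of a value means that the computation diverges.\<close>

datatype recf =
    Zero
  | Succ
  | Proj nat
  | Comp recf "recf list"
  | PrimRec recf recf
  | Mu recf

inductive rec_eval :: "recf \<Rightarrow> nat list \<Rightarrow> nat \<Rightarrow> bool" where
  Zero: "rec_eval Zero xs 0"
| Succ: "rec_eval Succ [x] (Suc x)"
| Proj: "i < length xs \<Longrightarrow> rec_eval (Proj i) xs (xs ! i)"
| Comp: "list_all2 (\<lambda>g y. rec_eval g xs y) gs ys \<Longrightarrow> rec_eval f ys z \<Longrightarrow> rec_eval (Comp f gs) xs z"
| PrimRec_0: "rec_eval f xs z \<Longrightarrow> rec_eval (PrimRec f g) (0 # xs) z"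
| PrimRec_Suc: "rec_eval (PrimRec f g) (n # xs) y \<Longrightarrow> rec_eval g (n # y # xs) z
    \<Longrightarrow> rec_eval (PrimRec f g) (Suc n # xs) z"
| Mu: "rec_eval f (n # xs) 0 \<Longrightarrow> \<forall>m<n. \<exists>y. rec_eval f (m # xs) (Suc y) \<Longrightarrow> rec_eval (Mu f) xs n"
monos list_all2_mono

inductive_cases rec_eval_ZeroE: "rec_eval Zero xs z"
inductive_cases rec_eval_SuccE: "rec_eval Succ xs z"
inductive_cases rec_eval_ProjE: "rec_eval (Proj i) xs z"
inductive_cases rec_eval_CompE: "rec_eval (Comp f gs) xs z"
inductive_cases rec_eval_PrimRec_0E: "rec_eval (PrimRec f g) (0 # xs) z"
inductive_cases rec_eval_PrimRec_SucE: "rec_eval (PrimRec f g) (Suc n # xs) z"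
inductive_cases rec_eval_MuE: "rec_eval (Mu f) xs z"

lemma rec_eval_deterministic:
  "rec_eval f xs y \<Longrightarrow> rec_eval f xs z \<Longrightarrow> y = z"
proof (induction f xs y arbitrary: z rule: rec_eval.induct)
  case (Zero xs)
  then show ?case by (rule rec_eval_ZeroE) simp
next
  case (Succ x)
  then show ?case by (rule rec_eval_SuccE) simp
next
  case (Proj i xs)
  from Proj.prems show ?case by (rule rec_eval_ProjE) simp
next
  case (Comp xs gs ys f w)
  from Comp.prems obtain ys' where ys': "list_all2 (\<lambda>g y. rec_eval g xs y) gs ys'" "rec_eval f ys' z"
    by (rule rec_eval_CompE)
  have "ys = ys'"
    using Comp.IH(1) ys'(1) by (auto simp: list_all2_conv_all_nth intro!: nth_equalityI)
  with ys' Comp.IH(2) show ?case by blast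
next
  case (PrimRec_0 f xs w g)
  from PrimRec_0.prems have "rec_eval f xs z" by (rule rec_eval_PrimRec_0E)
  then show ?case by (rule PrimRec_0.IH)
next
  case (PrimRec_Suc f g n xs y w)
  from PrimRec_Suc.prems obtain y' where
    y': "rec_eval (PrimRec f g) (n # xs) y'" "rec_eval g (n # y' # xs) z"
    by (rule rec_eval_PrimRec_SucE)
  from PrimRec_Suc.IH(1)[OF y'(1)] y'(2) show ?case by (simp add: PrimRec_Suc.IH(2))
next
  case (Mu f n xs)
  from Mu.prems have z: "rec_eval f (z # xs) 0" "\<forall>m<z. \<exists>y. rec_eval f (m # xs) (Suc y)"
    by (blast elim: rec_eval_MuE)+
  show ?case
  proof (cases n z rule: linorder_cases)
    case less
    with z(2) obtain y where "rec_eval f (n # xs) (Suc y)" by blast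
    from Mu.IH(1)[OF this] show ?thesis by simp
  next
    case greater
    with Mu.IH(2) obtain y where "\<forall>x. rec_eval f (z # xs) x \<longrightarrow> Suc y = x" by blast
    with z(1) show ?thesis by blast
  qed simp
qed


section \<open>Codes of inputs and outputs\<close>

text \<open>Every natural number is a code. A rational number is coded by a numerator and a positive
  denominator, not necessarily coprime, and a polynomial by a list of terms, each a coefficient
  paired with a list of exponents. The terms may be listed in any order and may repeat.\<close>

definition decode_rat :: "nat \<Rightarrow> rat" where
  "decode_rat c = (case prod_decode c of (p, q) \<Rightarrow> Fract (int_decode p) (int (Suc q)))"

definition decode_list :: "(nat \<Rightarrow> 'a) \<Rightarrow> nat \<Rightarrow> 'a list" where
  "decode_list d c = map d (list_decode c)"

definition decode_monomial :: "nat \<Rightarrow> (nat \<Rightarrow>\<^sub>0 nat)" where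
  "decode_monomial c = Poly_Mapping.nth (list_decode c)"

definition decode_term :: "nat \<Rightarrow> rat mpoly" where
  "decode_term c = (case prod_decode c of
     (q, e) \<Rightarrow> Poly_Mapping.single (decode_monomial e) (decode_rat q))"

definition decode_poly :: "nat \<Rightarrow> rat mpoly" where
  "decode_poly c = sum_list (decode_list decode_term c)"

lemma surj_decode_rat: "surj decode_rat"
proof (rule surjI)
  fix r :: rat
  show "decode_rat (prod_encode (int_encode (fst (quotient_of r)),
          nat (snd (quotient_of r)) - 1)) = r"
    using quotient_of_denom_pos'[of r]
    by (cases "quotient_of r")
      (auto simp: decode_rat_def Fract_of_int_quotient dest: quotient_of_div)
qed

lemma surj_decode_list: "surj (decode_list d)" if "surj d"
proof (rule surjI)
  fix xs
  show "decode_list d (list_encode (map (inv d) xs)) = xs"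
    using that by (simp add: decode_list_def surj_f_inv_f o_def)
qed

lemma surj_decode_monomial: "surj decode_monomial"
proof (rule surjI)
  fix m :: "nat \<Rightarrow>\<^sub>0 nat"
  show "decode_monomial (list_encode (map (Poly_Mapping.lookup m) [0..<Poly_Mapping.degree m])) = m"
    by (simp add: decode_monomial_def nth_idem)
qed

lemma surj_decode_poly: "surj decode_poly"
proof -
  have "\<exists>c. p = decode_poly c" for p
  proof -
    define t where "t m = Poly_Mapping.single m (Poly_Mapping.lookup p m)" for m
    obtain ms where ms: "set ms = Poly_Mapping.keys p" "distinct ms"
      using finite_distinct_list[OF finite_keys[of p]] by blast
    have "\<exists>c. decode_term c = t m" for m
    proof -
      obtain e where "m = decode_monomial e"
        using surj_decode_monomial by (rule surjE)
      moreover obtain q where "Poly_Mapping.lookup p m = decode_rat q"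
        using surj_decode_rat by (rule surjE)
      ultimately show ?thesis
        by (intro exI[of _ "prod_encode (q, e)"]) (simp add: decode_term_def t_def)
    qed
    then have "\<exists>c. \<forall>m. decode_term (c m) = t m" by (intro choice allI)
    then obtain c where c: "\<forall>m. decode_term (c m) = t m" ..
    have "p = (\<Sum>m\<in>Poly_Mapping.keys p. t m)"
      by (rule poly_mapping_eqI)
        (simp add: lookup_sum t_def lookup_single when_def in_keys_iff)
    also have "\<dots> = sum_list (map t ms)"
      using ms by (simp add: sum_list_distinct_conv_sum_set)
    also have "\<dots> = decode_poly (list_encode (map c ms))"
      by (simp add: decode_poly_def decode_list_def o_def c)
    finally show ?thesis by blast
  qed
  then show ?thesis unfolding surj_def by blast
qed

end

(* The algorithm is an unbounded search for a certificate. A polynomial in E is an invariant iff it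
   vanishes on the countable set R of rational points reachable through nonzero guards, so the
   invariants in E are the common kernel of the point evaluations at R. That a polynomial vanishes on
   R is witnessed by finitely many polynomials q containing it, vanishing at a, such that every
   h * (q o F_i) lies in the ideal generated by the q's: by Hilbert's basis theorem, generators of the
   vanishing ideal of R have this property. That the space is not larger than claimed is witnessed by
   elements of E dual to finitely many points of R, and linear independence by coefficients dual to
   the basis. All of these conditions are decidable identities between polynomials over the rationals. *)

theory Submission
  imports Defs
begin

section \<open>Recursive functions\<close>

text \<open>Only the verification of a certificate has to be computable; that some certificate
  exists for every admissible input is a purely mathematical fact, and it is what makes the search
  terminate. The factor \<open>h\<close> in the inductiveness condition encodes the guard: where the
  guard is nonzero, it can be cancelled from a vanishing product \<open>h * (q o F_i)\<close>, and
  where it vanishes, nothing is demanded of the successor. The output must be a basis over the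
  complex numbers, while all computation is rational. This is the reason for dual families: that a
  matrix of rational values is the identity is a finite check, it stays true after extension of
  scalars, and it reads off complex coefficients directly, so ranks or independence need not be
  transferred between the two fields. Cofactors and coefficients of linear combinations are searched
  for together with the rest, so membership in an ideal or a span is verified, never decided.
  Polynomials in a certificate may involve variables beyond the dimension; points are padded by
  zeros, which gives every polynomial a value.\<close>

definition recursive1 :: "(nat \<Rightarrow> nat) \<Rightarrow> bool" where
  "recursive1 f \<longleftrightarrow> (\<exists>r. \<forall>x. rec_eval r [x] (f x))"

definition recursive2 :: "(nat \<Rightarrow> nat \<Rightarrow> nat) \<Rightarrow> bool" where
  "recursive2 f \<longleftrightarrow> (\<exists>r. \<forall>x y. rec_eval r [x, y] (f x y))"

definition recursive3 :: "(nat \<Rightarrow> nat \<Rightarrow> nat \<Rightarrow> nat) \<Rightarrow> bool" where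
  "recursive3 f \<longleftrightarrow> (\<exists>r. \<forall>x y z. rec_eval r [x, y, z] (f x y z))"

lemma rec_eval_Comp1: "rec_eval g xs y \<Longrightarrow> rec_eval f [y] z \<Longrightarrow> rec_eval (Comp f [g]) xs z"
  by (rule rec_eval.Comp[where ys = "[y]"]) auto

lemma rec_eval_Comp2:
  "rec_eval g xs y \<Longrightarrow> rec_eval h xs y' \<Longrightarrow> rec_eval f [y, y'] z \<Longrightarrow> rec_eval (Comp f [g, h]) xs z"
  by (rule rec_eval.Comp[where ys = "[y, y']"]) auto

lemma recursive1_id: "recursive1 (\<lambda>x. x)"
  unfolding recursive1_def using rec_eval.Proj[of 0 "[_]"] by (auto intro!: exI[of _ "Proj 0"])

lemma recursive1_const: "recursive1 (\<lambda>_. k)"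
proof (induction k)
  case 0
  then show ?case unfolding recursive1_def using rec_eval.Zero by blast
next
  case (Suc k)
  then show ?case unfolding recursive1_def by (blast intro: rec_eval_Comp1 rec_eval.Succ)
qed

lemma recursive1_Suc: "recursive1 Suc"
  unfolding recursive1_def using rec_eval.Succ by blast

lemma recursive1_comp:
  assumes "recursive1 f" "recursive1 g"
  shows "recursive1 (\<lambda>x. f (g x))"
proof -
  obtain r where "\<And>x. rec_eval r [x] (f x)"
    using assms(1) unfolding recursive1_def by blast
  moreover obtain s where "\<And>x. rec_eval s [x] (g x)"
    using assms(2) unfolding recursive1_def by blast
  ultimately have "rec_eval (Comp r [s]) [x] (f (g x))" for x
    by (blast intro: rec_eval_Comp1)
  then show ?thesis unfolding recursive1_def by blast
qed

lemma recursive1_comp2: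
  assumes "recursive2 f" "recursive1 g" "recursive1 h"
  shows "recursive1 (\<lambda>x. f (g x) (h x))"
proof -
  obtain r where r: "\<And>x y. rec_eval r [x, y] (f x y)"
    using assms(1) unfolding recursive2_def by blast
  obtain s where s: "\<And>x. rec_eval s [x] (g x)"
    using assms(2) unfolding recursive1_def by blast
  obtain t where t: "\<And>x. rec_eval t [x] (h x)"
    using assms(3) unfolding recursive1_def by blast
  have "rec_eval (Comp r [s, t]) [x] (f (g x) (h x))" for x
    by (rule rec_eval_Comp2[OF s t r])
  then show ?thesis unfolding recursive1_def by blast
qed

lemma recursive2_fst: "recursive2 (\<lambda>x y. x)"
  unfolding recursive2_def using rec_eval.Proj[of 0 "[_, _]"] by (auto intro!: exI[of _ "Proj 0"])

lemma recursive2_snd: "recursive2 (\<lambda>x y. y)"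
  unfolding recursive2_def using rec_eval.Proj[of 1 "[_, _]"] by (auto intro!: exI[of _ "Proj 1"])

lemma recursive2_comp:
  assumes "recursive1 f" "recursive2 g"
  shows "recursive2 (\<lambda>x y. f (g x y))"
proof -
  obtain r where "\<And>x. rec_eval r [x] (f x)"
    using assms(1) unfolding recursive1_def by blast
  moreover obtain s where "\<And>x y. rec_eval s [x, y] (g x y)"
    using assms(2) unfolding recursive2_def by blast
  ultimately have "rec_eval (Comp r [s]) [x, y] (f (g x y))" for x y
    by (blast intro: rec_eval_Comp1)
  then show ?thesis unfolding recursive2_def by blast
qed

lemma recursive2_comp2:
  assumes "recursive2 f" "recursive2 g" "recursive2 h"
  shows "recursive2 (\<lambda>x y. f (g x y) (h x y))"
proof -
  obtain r where r: "\<And>x y. rec_eval r [x, y] (f x y)"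
    using assms(1) unfolding recursive2_def by blast
  obtain s where s: "\<And>x y. rec_eval s [x, y] (g x y)"
    using assms(2) unfolding recursive2_def by blast
  obtain t where t: "\<And>x y. rec_eval t [x, y] (h x y)"
    using assms(3) unfolding recursive2_def by blast
  have "rec_eval (Comp r [s, t]) [x, y] (f (g x y) (h x y))" for x y
    by (rule rec_eval_Comp2[OF s t r])
  then show ?thesis unfolding recursive2_def by blast
qed

lemma recursive3_proj1: "recursive3 (\<lambda>x y z. x)"
  unfolding recursive3_def using rec_eval.Proj[of 0 "[_, _, _]"] by (auto intro!: exI[of _ "Proj 0"])

lemma recursive3_proj2: "recursive3 (\<lambda>x y z. y)"
  unfolding recursive3_def using rec_eval.Proj[of 1 "[_, _, _]"] by (auto intro!: exI[of _ "Proj 1"])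

lemma recursive3_proj3: "recursive3 (\<lambda>x y z. z)"
  unfolding recursive3_def using rec_eval.Proj[of 2 "[_, _, _]"] by (auto intro!: exI[of _ "Proj 2"])

lemma recursive3_comp:
  assumes "recursive1 f" "recursive3 g"
  shows "recursive3 (\<lambda>x y z. f (g x y z))"
proof -
  obtain r where "\<And>x. rec_eval r [x] (f x)"
    using assms(1) unfolding recursive1_def by blast
  moreover obtain s where "\<And>x y z. rec_eval s [x, y, z] (g x y z)"
    using assms(2) unfolding recursive3_def by blast
  ultimately have "rec_eval (Comp r [s]) [x, y, z] (f (g x y z))" for x y z
    by (blast intro: rec_eval_Comp1)
  then show ?thesis unfolding recursive3_def by blast
qed

lemma recursive3_comp2:
  assumes "recursive2 f" "recursive3 g" "recursive3 h"
  shows "recursive3 (\<lambda>x y z. f (g x y z) (h x y z))"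
proof -
  obtain r where r: "\<And>x y. rec_eval r [x, y] (f x y)"
    using assms(1) unfolding recursive2_def by blast
  obtain s where s: "\<And>x y z. rec_eval s [x, y, z] (g x y z)"
    using assms(2) unfolding recursive3_def by blast
  obtain t where t: "\<And>x y z. rec_eval t [x, y, z] (h x y z)"
    using assms(3) unfolding recursive3_def by blast
  have "rec_eval (Comp r [s, t]) [x, y, z] (f (g x y z) (h x y z))" for x y z
    by (rule rec_eval_Comp2[OF s t r])
  then show ?thesis unfolding recursive3_def by blast
qed

text \<open>The argument order of \<open>g\<close> is dictated by \<open>PrimRec\<close>: counter,
  previous value, parameter.\<close>

lemma recursive2_rec_nat:
  assumes "recursive1 f" "recursive3 g"
  shows "recursive2 (\<lambda>n x. rec_nat (f x) (\<lambda>k y. g k y x) n)"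
proof -
  obtain r s where r: "\<And>x. rec_eval r [x] (f x)" and s: "\<And>x y z. rec_eval s [x, y, z] (g x y z)"
    using assms unfolding recursive1_def recursive3_def by blast
  have "rec_eval (PrimRec r s) [n, x] (rec_nat (f x) (\<lambda>k y. g k y x) n)" for n x
    by (induction n) (auto intro: r s rec_eval.PrimRec_0 rec_eval.PrimRec_Suc)
  then show ?thesis unfolding recursive2_def by blast
qed

text \<open>\<open>Mu\<close> needs a positive value at every argument before the first zero;
  totality of \<open>f\<close> supplies these values, and \<open>ex\<close> makes the result
  total.\<close>

lemma recursive1_Least:
  assumes "recursive2 f" and ex: "\<And>x. \<exists>n. f n x = 0"
  shows "recursive1 (\<lambda>x. LEAST n. f n x = 0)"
proof -
  obtain r where r: "\<And>x y. rec_eval r [x, y] (f x y)"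
    using assms(1) unfolding recursive2_def by blast
  have "rec_eval (Mu r) [x] (LEAST n. f n x = 0)" for x
  proof (rule rec_eval.Mu)
    show "rec_eval r [LEAST n. f n x = 0, x] 0"
      using r[of "LEAST n. f n x = 0" x] LeastI_ex[OF ex[of x]] by simp
    have "f m x \<noteq> 0" if "m < (LEAST n. f n x = 0)" for m
      using that by (rule not_less_Least)
    then show "\<forall>m<LEAST n. f n x = 0. \<exists>y. rec_eval r [m, x] (Suc y)"
      using r by (metis old.nat.exhaust)
  qed
  then show ?thesis unfolding recursive1_def by blast
qed

section \<open>Arithmetic and the pairing function\<close>

lemma recursive2_add: "recursive2 (+)"
proof -
  have "rec_nat x (\<lambda>_ y. Suc y) n = n + x" for n x :: nat
    by (induction n) auto
  then show ?thesis
    using recursive2_rec_nat[OF recursive1_id recursive3_comp[OF recursive1_Suc recursive3_proj2]]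
    by (simp add: fun_eq_iff)
qed

lemma recursive1_rec_nat:
  assumes "recursive2 g"
  shows "recursive1 (rec_nat c g)"
proof -
  have "recursive3 (\<lambda>k y x. g k y)"
    by (rule recursive3_comp2[OF assms recursive3_proj1 recursive3_proj2])
  from recursive1_comp2[OF recursive2_rec_nat[OF recursive1_const this] recursive1_id recursive1_id]
  show ?thesis by simp
qed

lemma recursive2_diff: "recursive2 (-)"
proof -
  \<comment> \<open>The predecessor: the step returns the counter, which is one less than the number
    of iterations.\<close>
  have "rec_nat 0 (\<lambda>k _. k) n = n - 1" for n :: nat
    by (cases n) auto
  then have "rec_nat 0 (\<lambda>k _. k) = (\<lambda>n :: nat. n - 1)" by (rule ext)
  with recursive1_rec_nat[OF recursive2_fst, of 0] have pred: "recursive1 (\<lambda>n. n - 1)"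
    by (simp only:)
  have "rec_nat x (\<lambda>_ y. y - 1) n = x - n" for n x :: nat
    by (induction n) auto
  then have "recursive2 (\<lambda>n x. x - n)"
    using recursive2_rec_nat[OF recursive1_id recursive3_comp[OF pred recursive3_proj2]]
    by simp
  from recursive2_comp2[OF this recursive2_snd recursive2_fst] show ?thesis .
qed

lemma recursive1_triangle: "recursive1 triangle"
proof -
  have "rec_nat 0 (\<lambda>k y. y + Suc k) n = triangle n" for n
    by (induction n) auto
  then have "rec_nat 0 (\<lambda>k y. y + Suc k) = triangle" by (rule ext)
  then show ?thesis
    using recursive1_rec_nat[OF recursive2_comp2[OF recursive2_add recursive2_snd
      recursive2_comp[OF recursive1_Suc recursive2_fst]], of 0]
    by simp
qed

lemma recursive2_prod_encode: "recursive2 (\<lambda>x y. prod_encode (x, y))"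
  unfolding prod_encode_def case_prod_conv
  by (intro recursive2_comp2[OF recursive2_add] recursive2_comp[OF recursive1_triangle]
      recursive2_add recursive2_fst recursive2_snd)

text \<open>A pair \<open>(m, n)\<close> lies on the diagonal \<open>m + n\<close> and has the code
  \<open>triangle (m + n) + m\<close>, so \<open>k\<close> is the diagonal of \<open>c\<close>, the
  least \<open>k\<close> with \<open>c < triangle (Suc k)\<close>. Truncated subtraction turns this
  inequality into an equation with 0, the form required by \<open>recursive1_Least\<close>.\<close>

lemma prod_decode_unfold:
  fixes c defines "k \<equiv> LEAST k. Suc c - triangle (Suc k) = 0"
  shows "prod_decode c = (c - triangle k, k - (c - triangle k))"
proof -
  obtain m n where mn: "prod_decode c = (m, n)" by (cases "prod_decode c")
  then have c: "c = triangle (m + n) + m"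
    using prod_decode_inverse[of c] by (simp add: prod_encode_def)
  have mono: "triangle i \<le> triangle j" if "i \<le> j" for i j
    using that by (induction rule: dec_induct) auto
  have "k = m + n" unfolding k_def
  proof (rule Least_equality)
    show "Suc c - triangle (Suc (m + n)) = 0" by (simp add: c)
    fix j assume "Suc c - triangle (Suc j) = 0"
    then show "m + n \<le> j" using mono[of "Suc j" "m + n"] c by (cases "m + n \<le> j") auto
  qed
  with c mn show ?thesis by simp
qed

lemma
  recursive1_fst_prod_decode: "recursive1 (\<lambda>c. fst (prod_decode c))" and
  recursive1_snd_prod_decode: "recursive1 (\<lambda>c. snd (prod_decode c))"
proof -
  define k where "k c = (LEAST k. Suc c - triangle (Suc k) = 0)" for c
  have "c \<le> triangle c" for c by (induction c) auto
  then have ex: "\<exists>k. Suc c - triangle (Suc k) = 0" for c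
    by (intro exI[of _ c]) (auto simp: le_Suc_eq)
  have k: "recursive1 k" unfolding k_def
    by (intro recursive1_Least ex recursive2_comp2[OF recursive2_diff]
      recursive2_comp[OF recursive1_Suc] recursive2_comp[OF recursive1_triangle]
      recursive2_fst recursive2_snd)
  have m: "recursive1 (\<lambda>c. c - triangle (k c))"
    by (intro recursive1_comp2[OF recursive2_diff] recursive1_comp[OF recursive1_triangle] k
      recursive1_id)
  then show "recursive1 (\<lambda>c. fst (prod_decode c))"
    by (simp only: prod_decode_unfold k_def fst_conv)
  from k m have "recursive1 (\<lambda>c. k c - (c - triangle (k c)))"
    by (rule recursive1_comp2[OF recursive2_diff])
  then show "recursive1 (\<lambda>c. snd (prod_decode c))"
    by (simp only: prod_decode_unfold k_def snd_conv)
qed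

section \<open>Computable functions on decodable types\<close>

text \<open>Only surjectivity is asked for, because rationals and polynomials have many codes. There
  is no canonical code of an element, and hence no encoding function.\<close>

class decodable =
  fixes dec :: "nat \<Rightarrow> 'a"
  assumes surj_dec: "surj dec"

lemma dec_ex: "\<exists>c. dec c = (x :: 'a :: decodable)"
  using surj_dec by (metis surjD)

instantiation nat :: decodable
begin
definition "dec c = (c :: nat)"
instance by standard (auto simp: dec_nat_def)
end

text \<open>Truth is coded by 0 because this is the value that \<open>Mu\<close> searches for.\<close>

instantiation bool :: decodable
begin
definition "dec c \<longleftrightarrow> c = 0"
instance
proof
  show "surj (dec :: nat \<Rightarrow> bool)"
  proof (rule surjI)
    show "dec (if b then 0 else 1) = b" for b by (simp add: dec_bool_def)
  qed
qed
end

instantiation int :: decodable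
begin
definition "dec = int_decode"
instance by standard (simp add: dec_int_def surj_int_decode)
end

instantiation rat :: decodable
begin
definition "dec = decode_rat"
instance by standard (simp add: dec_rat_def surj_decode_rat)
end

instantiation prod :: (decodable, decodable) decodable
begin
definition "dec c = (dec (fst (prod_decode c)), dec (snd (prod_decode c)))"
instance
proof
  show "surj (dec :: nat \<Rightarrow> 'a \<times> 'b)"
    unfolding surj_def
  proof
    fix p :: "'a \<times> 'b"
    obtain c where "dec c = fst p" using dec_ex by blast
    moreover obtain d where "dec d = snd p" using dec_ex by blast
    ultimately have "p = dec (prod_encode (c, d))" by (simp add: dec_prod_def)
    then show "\<exists>c. p = dec c" ..
  qed
qed
end

instantiation list :: (decodable) decodable
begin
definition "dec = decode_list dec"
instance by standard (simp add: dec_list_def surj_decode_list surj_dec)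
end

lemma dec_prod_encode [simp]: "dec (prod_encode (c, d)) = (dec c, dec d)"
  by (simp add: dec_prod_def)

lemma dec_list_0 [simp]: "dec 0 = []"
  by (simp add: dec_list_def decode_list_def)

lemma dec_list_Suc [simp]:
  "dec (Suc c) = dec (fst (prod_decode c)) # dec (snd (prod_decode c))"
  by (simp add: dec_list_def decode_list_def split: prod.split)

text \<open>A total recursive function on codes realizes \<open>f\<close>. With the type fixing the
  coding, closure properties can be applied along the structure of a term, where \<open>x\<close>
  stands for the whole context of free variables.\<close>

definition computable :: "('a :: decodable \<Rightarrow> 'b :: decodable) \<Rightarrow> bool" where
  "computable f \<longleftrightarrow> (\<exists>\<phi>. recursive1 \<phi> \<and> (\<forall>c. dec (\<phi> c) = f (dec c)))"

lemma computableI: "recursive1 \<phi> \<Longrightarrow> (\<And>c. dec (\<phi> c) = f (dec c)) \<Longrightarrow> computable f"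
  unfolding computable_def by blast

lemma computableE:
  assumes "computable f"
  obtains \<phi> where "recursive1 \<phi>" "\<And>c. dec (\<phi> c) = f (dec c)"
  using assms unfolding computable_def by blast

named_theorems computable_intros

lemma computable_id [computable_intros]: "computable (\<lambda>x. x)"
  by (rule computableI[OF recursive1_id]) simp

lemma computable_const [computable_intros]: "computable (\<lambda>_. k)"
proof -
  obtain c where "dec c = k" using dec_ex by blast
  then show ?thesis by (intro computableI[OF recursive1_const[of c]]) simp
qed

lemma computable_comp: "computable f \<Longrightarrow> computable g \<Longrightarrow> computable (\<lambda>x. f (g x))"

  by (elim computableE, rule computableI, rule recursive1_comp, assumption+) (simp only:)

lemma computable_dec: "computable dec"
  by (rule computableI[OF recursive1_id]) (simp add: dec_nat_def)

lemma computable_recursive1: "recursive1 f \<Longrightarrow> computable f"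
  by (rule computableI) (simp_all add: dec_nat_def)

lemma computable_Pair [computable_intros]:
  assumes "computable f" "computable g"
  shows "computable (\<lambda>x. (f x, g x))"
proof -
  from assms(1) obtain \<phi> where \<phi>: "recursive1 \<phi>" "\<And>c. dec (\<phi> c) = f (dec c)"
    by (rule computableE) (simp add: that)
  from assms(2) obtain \<psi> where \<psi>: "recursive1 \<psi>" "\<And>c. dec (\<psi> c) = g (dec c)"
    by (rule computableE) (simp add: that)
  from \<phi>(1) \<psi>(1) have "recursive1 (\<lambda>c. prod_encode (\<phi> c, \<psi> c))"
    by (intro recursive1_comp2[OF recursive2_prod_encode])
  then show ?thesis by (rule computableI) (simp add: \<phi> \<psi>)
qed

lemma computable_fst [computable_intros]: "computable f \<Longrightarrow> computable (\<lambda>x. fst (f x))"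
  by (rule computable_comp, rule computableI[OF recursive1_fst_prod_decode])
    (simp_all add: dec_prod_def)

lemma computable_snd [computable_intros]: "computable f \<Longrightarrow> computable (\<lambda>x. snd (f x))"
  by (rule computable_comp, rule computableI[OF recursive1_snd_prod_decode])
    (simp_all add: dec_prod_def)

lemma computable_lift2:
  assumes "computable (\<lambda>p. k (fst p) (snd p))" "computable f" "computable g"
  shows "computable (\<lambda>x. k (f x) (g x))"
  using computable_comp[OF assms(1) computable_Pair[OF assms(2,3)]] by simp

lemma computable_recursive2:
  assumes "recursive2 k" "computable f" "computable g"
  shows "computable (\<lambda>x. k (f x) (g x))"
proof (rule computable_lift2[OF _ assms(2,3)], rule computableI)
  show "recursive1 (\<lambda>c. k (fst (prod_decode c)) (snd (prod_decode c)))"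
    by (intro recursive1_comp2[OF assms(1)] recursive1_fst_prod_decode recursive1_snd_prod_decode)
qed (simp add: dec_nat_def dec_prod_def)

lemmas computable_add_nat [computable_intros] = computable_recursive2[OF recursive2_add]
lemmas computable_diff_nat [computable_intros] = computable_recursive2[OF recursive2_diff]

lemma computable_Suc [computable_intros]: "computable f \<Longrightarrow> computable (\<lambda>x. Suc (f x))"
  by (rule computable_comp[OF computable_recursive1[OF recursive1_Suc]])

text \<open>The context \<open>x\<close> is passed to the recursion as a code, so the step may
  depend on it as well as on the counter and the previous value.\<close>

lemma computable_rec_nat [computable_intros]:
  assumes "computable f" "computable (\<lambda>z. g (fst z) (fst (snd z)) (snd (snd z)))" "computable m"
  shows "computable (\<lambda>x. rec_nat (f x) (g x) (m x))"
proof -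
  from assms(1) obtain \<phi> where \<phi>: "recursive1 \<phi>" "\<And>c. dec (\<phi> c) = f (dec c)"
    by (rule computableE) (simp add: that)
  from assms(2) obtain \<gamma> where \<gamma>: "recursive1 \<gamma>"
    "\<And>c. dec (\<gamma> c) = (\<lambda>z. g (fst z) (fst (snd z)) (snd (snd z))) (dec c)"
    by (rule computableE) (rule that)
  from assms(3) obtain \<mu> where \<mu>: "recursive1 \<mu>" "\<And>c. \<mu> c = m (dec c)"
    by (rule computableE) (simp add: dec_nat_def)
  have "recursive3 (\<lambda>n y c. \<gamma> (prod_encode (c, prod_encode (n, y))))"
    by (intro recursive3_comp[OF \<gamma>(1)] recursive3_comp2[OF recursive2_prod_encode]
      recursive3_proj1 recursive3_proj2 recursive3_proj3)
  from recursive1_comp2[OF recursive2_rec_nat[OF \<phi>(1) this] \<mu>(1) recursive1_id]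
  show ?thesis
  proof (rule computableI)
    fix c
    have "dec (rec_nat (\<phi> c) (\<lambda>k y. \<gamma> (prod_encode (c, prod_encode (k, y)))) n)
        = rec_nat (f (dec c)) (g (dec c)) n" for n
      by (induction n) (simp_all add: \<phi> \<gamma> dec_nat_def)
    then show "dec (rec_nat (\<phi> c) (\<lambda>k y. \<gamma> (prod_encode (c, prod_encode (k, y)))) (\<mu> c))
        = rec_nat (f (dec c)) (g (dec c)) (m (dec c))"
      by (simp add: \<mu>)
  qed
qed

text \<open>Recursion over the code of the truth value replaces the case distinction: code 0 (true)
  returns the base value, and any other code runs a step that discards the previous value.\<close>

lemma computable_if [computable_intros]:
  assumes "computable b" "computable f" "computable g"
  shows "computable (\<lambda>x. if b x then f x else g x)"
proof -
  obtain \<beta> where \<beta>: "recursive1 \<beta>" "\<And>c. b (dec c) \<longleftrightarrow> \<beta> c = 0"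
    using assms(1) by (elim computableE) (simp add: dec_bool_def)
  have "computable (\<lambda>c. rec_nat (f (dec c)) (\<lambda>_ _. g (dec c)) (\<beta> c))"
    using \<beta>(1) assms(2,3)
    by (intro computable_rec_nat computable_comp[OF assms(2)] computable_comp[OF assms(3)]
      computable_comp[OF computable_dec] computable_recursive1 computable_intros)
  moreover have "rec_nat (f (dec c)) (\<lambda>_ _. g (dec c)) (\<beta> c) = (if b (dec c) then f (dec c) else g (dec c))" for c
    by (cases "\<beta> c") (auto simp: \<beta>(2))
  ultimately have "computable (\<lambda>c :: nat. if b (dec c) then f (dec c) else g (dec c))"
    by simp
  then show ?thesis
    by (elim computableE) (rule computableI, auto simp: dec_nat_def)
qed

lemma computable_not [computable_intros]:
  assumes "computable f"
  shows "computable (\<lambda>x. \<not> f x)"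
proof -
  have "computable (\<lambda>x. if f x then False else True)"
    by (intro computable_if computable_const assms)
  moreover have "(\<lambda>x. if f x then False else True) = (\<lambda>x. \<not> f x)" by auto
  ultimately show ?thesis by (simp only:)
qed

lemma computable_conj [computable_intros]:
  assumes "computable f" "computable g"
  shows "computable (\<lambda>x. f x \<and> g x)"
proof -
  have "computable (\<lambda>x. if f x then g x else False)"
    by (intro computable_if computable_const assms)
  moreover have "(\<lambda>x. if f x then g x else False) = (\<lambda>x. f x \<and> g x)" by auto
  ultimately show ?thesis by (simp only:)
qed

lemma computable_zero_nat: "computable (\<lambda>n :: nat. n = 0)"
  by (rule computableI[OF recursive1_id]) (simp add: dec_nat_def dec_bool_def)

lemma computable_le_nat [computable_intros]:
  fixes f g :: "_ \<Rightarrow> nat"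
  assumes "computable f" "computable g"
  shows "computable (\<lambda>x. f x \<le> g x)"
  using computable_comp[OF computable_zero_nat computable_diff_nat[OF assms]] by simp

lemma computable_less_nat [computable_intros]:
  fixes f g :: "_ \<Rightarrow> nat"
  assumes "computable f" "computable g"
  shows "computable (\<lambda>x. f x < g x)"
  using computable_not[OF computable_le_nat[OF assms(2,1)]] by (simp add: not_le)

lemma computable_eq_nat [computable_intros]:
  fixes f g :: "_ \<Rightarrow> nat"
  assumes "computable f" "computable g"
  shows "computable (\<lambda>x. f x = g x)"
  using computable_conj[OF computable_le_nat[OF assms] computable_le_nat[OF assms(2,1)]]
  by (simp add: order.eq_iff)

lemma computable_mult_nat [computable_intros]:
  fixes f g :: "_ \<Rightarrow> nat"
  assumes "computable f" "computable g"
  shows "computable (\<lambda>x. f x * g x)"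
proof -
  have "rec_nat 0 (\<lambda>_ y. y + b) a = a * b" for a b :: nat
    by (induction a) auto
  moreover have "computable (\<lambda>x. rec_nat 0 (\<lambda>_ y. y + g x) (f x))"
    by (intro computable_intros assms computable_comp[OF assms(2)])
  ultimately show ?thesis by simp
qed

lemma computable_all_less [computable_intros]:
  fixes m :: "'a :: decodable \<Rightarrow> nat"
  assumes "computable m" "computable (\<lambda>z. P (fst z) (snd z))"
  shows "computable (\<lambda>x. \<forall>i<m x. P x i)"
proof -
  have "rec_nat True (\<lambda>k y. P x k \<and> y) n \<longleftrightarrow> (\<forall>i<n. P x i)" for x n
    by (induction n) (auto simp: less_Suc_eq)
  moreover have "computable (\<lambda>x. rec_nat True (\<lambda>k y. P x k \<and> y) (m x))"
    by (intro computable_rec_nat computable_conj assms computable_const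
        computable_lift2[OF assms(2)] computable_intros)
  ultimately show ?thesis by simp
qed

lemma computable_ex_less [computable_intros]:
  fixes m :: "'a :: decodable \<Rightarrow> nat"
  assumes "computable m" "computable (\<lambda>z. P (fst z) (snd z))"
  shows "computable (\<lambda>x. \<exists>i<m x. P x i)"
  using computable_not[OF computable_all_less[OF assms(1) computable_not[OF assms(2)]]]
  by simp

subsection \<open>Lists\<close>

text \<open>A natural number is its own code, so a realizer may be built by inspecting the code of
  the argument, as a case distinction or a bound on the number of iterations requires.\<close>

lemma computable_codeI: "computable (\<lambda>c :: nat. f (dec c)) \<Longrightarrow> computable f"
  by (elim computableE) (rule computableI, auto simp: dec_nat_def)

lemma computable_Cons [computable_intros]:
  assumes "computable f" "computable g"
  shows "computable (\<lambda>x. f x # g x)"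
proof -
  from assms(1) obtain \<phi> where \<phi>: "recursive1 \<phi>" "\<And>c. dec (\<phi> c) = f (dec c)"
    by (rule computableE) (simp add: that)
  from assms(2) obtain \<psi> where \<psi>: "recursive1 \<psi>" "\<And>c. dec (\<psi> c) = g (dec c)"
    by (rule computableE) (simp add: that)
  from \<phi>(1) \<psi>(1) have "recursive1 (\<lambda>c. Suc (prod_encode (\<phi> c, \<psi> c)))"
    by (intro recursive1_comp[OF recursive1_Suc] recursive1_comp2[OF recursive2_prod_encode])
  then show ?thesis by (rule computableI) (simp add: \<phi> \<psi>)
qed

text \<open>A list has code 0 if it is empty and otherwise the successor of a pair code, so
  \<open>\<mu> c - 1\<close> is meaningful exactly in the second branch.\<close>

lemma computable_case_list [computable_intros]:
  assumes "computable l" "computable f" "computable (\<lambda>z. g (fst z) (fst (snd z)) (snd (snd z)))"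
  shows "computable (\<lambda>x. case l x of [] \<Rightarrow> f x | y # ys \<Rightarrow> g x y ys)"
proof (rule computable_codeI)
  obtain \<mu> where \<mu>: "recursive1 \<mu>" "\<And>c. l (dec c) = dec (\<mu> c)"
    using assms(1) by (elim computableE) simp
  note cl = computable_recursive1[OF \<mu>(1)]
  have "computable (\<lambda>c. if \<mu> c = 0 then f (dec c) else
    g (dec c) (dec (fst (prod_decode (\<mu> c - 1)))) (dec (snd (prod_decode (\<mu> c - 1)))))"
  proof -
    have "computable (\<lambda>c. (dec c, dec (fst (prod_decode (\<mu> c - 1))),
        dec (snd (prod_decode (\<mu> c - 1)))))"
      by (intro computable_Pair computable_dec computable_comp[OF computable_dec]
        computable_comp[OF computable_recursive1[OF recursive1_fst_prod_decode]]
        computable_comp[OF computable_recursive1[OF recursive1_snd_prod_decode]]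
        computable_diff_nat computable_const cl)
    from computable_comp[OF assms(3) this]
    have "computable (\<lambda>c. g (dec c) (dec (fst (prod_decode (\<mu> c - 1))))
        (dec (snd (prod_decode (\<mu> c - 1)))))"
      by (simp only: fst_conv snd_conv)
    then show ?thesis
      by (intro computable_if computable_comp[OF assms(2) computable_dec] computable_eq_nat
        computable_const cl)
  qed
  moreover have "(if \<mu> c = 0 then f (dec c) else
    g (dec c) (dec (fst (prod_decode (\<mu> c - 1)))) (dec (snd (prod_decode (\<mu> c - 1)))))
    = (case l (dec c) of [] \<Rightarrow> f (dec c) | y # ys \<Rightarrow> g (dec c) y ys)" for c
    by (cases "\<mu> c") (auto simp: \<mu>(2))
  ultimately show "computable (\<lambda>c :: nat. case l (dec c) of [] \<Rightarrow> f (dec c) | y # ys \<Rightarrow> g (dec c) y ys)"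
    by simp
qed

text \<open>Every tail has a strictly smaller code, since the components of a pair never exceed its
  code.\<close>

lemma length_dec_le: "length (dec c) \<le> c"
proof (induction c rule: less_induct)
  case (less c)
  show ?case
  proof (cases c)
    case (Suc d)
    have "snd (prod_decode d) \<le> d"
      by (metis le_prod_encode_2 prod.collapse prod_decode_inverse)
    with less[of "snd (prod_decode d)"] show ?thesis by (auto simp: Suc)
  qed simp
qed

text \<open>The code of a list bounds its length, so it can serve as the number of iterations.\<close>

lemma computable_fold [computable_intros]:
  assumes "computable (\<lambda>z. f (fst z) (fst (snd z)) (snd (snd z)))" "computable l" "computable a"
  shows "computable (\<lambda>x. fold (f x) (l x) (a x))"
proof (rule computable_codeI)
  obtain \<mu> where \<mu>: "recursive1 \<mu>" "\<And>c. l (dec c) = dec (\<mu> c)"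
    using assms(2) by (elim computableE) simp
  \<comment> \<open>The state consists of the remaining list and the accumulator. It no longer
    changes once the list is empty, so surplus iterations are harmless.\<close>
  define step where "step x s = (case fst s of [] \<Rightarrow> s | y # ys \<Rightarrow> (ys, f x y (snd s)))" for x s
  have step: "fold (f x) l b = snd (rec_nat (l, b) (\<lambda>_. step x) n)" if "length l \<le> n" for x l b n
  proof -
    have step_Nil: "step x ([], b) = ([], b)" and step_Cons: "step x (y # ys, b) = (ys, f x y b)"
      for y ys b by (simp_all add: step_def)
    \<comment> \<open>\<open>rec_nat\<close> adds its step at the outside, whereas
      \<open>fold\<close> consumes the head first; the shift reconciles the two.\<close>
    have Suc_shift: "rec_nat s (\<lambda>_. step x) (Suc n) = rec_nat (step x s) (\<lambda>_. step x) n" for s n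
      by (induction n) auto
    have Nil: "rec_nat ([], b) (\<lambda>_. step x) n = ([], b)" for b n
      by (induction n) (auto simp: step_Nil)
    from that show ?thesis
    proof (induction n arbitrary: l b)
      case 0
      then show ?case by simp
    next
      case (Suc n)
      show ?case
      proof (cases l)
        case (Cons y ys)
        with Suc show ?thesis by (simp only: Suc_shift step_Cons) simp
      qed (simp only: Nil fold_Nil id_apply snd_conv)
    qed
  qed
  have cstep: "computable (\<lambda>z. step (dec (fst z :: nat)) (snd (snd z)))"
    unfolding step_def
    by (intro computable_intros computable_comp[OF assms(1), of "\<lambda>z. (dec (fst (fst z)), fst (snd z), snd (snd (snd (fst z))))", simplified]
        computable_comp[OF computable_dec])
  have "computable (\<lambda>c. snd (rec_nat (dec (\<mu> c), a (dec c)) (\<lambda>_. step (dec c)) (\<mu> c)))"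
    by (intro computable_snd computable_rec_nat computable_Pair
        computable_comp[OF assms(3)] computable_comp[OF computable_dec] computable_dec
        computable_recursive1[OF \<mu>(1)] cstep)
  then show "computable (\<lambda>c :: nat. fold (f (dec c)) (l (dec c)) (a (dec c)))"
    by (simp add: step[OF length_dec_le] \<mu>(2))
qed

lemma computable_rev [computable_intros]: "computable l \<Longrightarrow> computable (\<lambda>x. rev (l x))"
  by (simp only: rev_conv_fold) (intro computable_intros)

lemma computable_foldr [computable_intros]:
  assumes "computable (\<lambda>z. f (fst z) (fst (snd z)) (snd (snd z)))" "computable l" "computable a"
  shows "computable (\<lambda>x. foldr (f x) (l x) (a x))"
  unfolding foldr_conv_fold by (intro computable_intros assms)

lemma foldr_Cons_append: "foldr (#) xs ys = xs @ ys"
  by (induction xs) auto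

lemma computable_append [computable_intros]:
  "computable f \<Longrightarrow> computable g \<Longrightarrow> computable (\<lambda>x. f x @ g x)"
  by (simp only: foldr_Cons_append[symmetric]) (intro computable_intros)

lemma computable_map [computable_intros]:
  assumes "computable (\<lambda>z. f (fst z) (snd z))" "computable l"
  shows "computable (\<lambda>x. map (f x) (l x))"
proof -
  have "computable (\<lambda>x. foldr (\<lambda>y ys. f x y # ys) (l x) [])"
    by (intro computable_intros assms computable_lift2[OF assms(1)])
  moreover have "foldr (\<lambda>y ys. f x y # ys) l [] = map (f x) l" for x l
    by (induction l) auto
  ultimately show ?thesis by simp
qed

lemma computable_concat [computable_intros]:
  "computable l \<Longrightarrow> computable (\<lambda>x. concat (l x))"
  by (simp only: concat_conv_foldr) (intro computable_intros)

lemma computable_length [computable_intros]: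
  fixes l :: "'a :: decodable \<Rightarrow> 'b :: decodable list"
  assumes "computable l" shows "computable (\<lambda>x. length (l x))"
proof -
  have "foldr (\<lambda>_. Suc) l 0 = length l" for l :: "'b list" by (induction l) auto
  moreover have "computable (\<lambda>x. foldr (\<lambda>_. Suc) (l x) 0)" by (intro computable_intros assms)
  ultimately show ?thesis by simp
qed

lemma computable_upt [computable_intros]:
  assumes "computable m" shows "computable (\<lambda>x. [0..<m x])"
proof -
  have "rec_nat [] (\<lambda>k y. y @ [k]) n = [0..<n]" for n by (induction n) auto
  moreover have "computable (\<lambda>x. rec_nat [] (\<lambda>k y. y @ [k]) (m x))" by (intro computable_intros assms)
  ultimately show ?thesis by simp
qed

lemma computable_nth_default [computable_intros]:
  assumes "computable d" "computable l" "computable i"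
  shows "computable (\<lambda>x. nth_default (d x) (l x) (i x))"
proof -
  have "rec_nat l (\<lambda>_ l'. case l' of [] \<Rightarrow> [] | y # ys \<Rightarrow> ys) i = drop i l" for l :: "'b list" and i
    by (induction i) (auto simp: drop_Suc tl_drop split: list.split simp flip: list.case_eq_if, metis tl_drop list.sel)
  then have "nth_default d l i = (case rec_nat l (\<lambda>_ l'. case l' of [] \<Rightarrow> [] | y # ys \<Rightarrow> ys) i of
      [] \<Rightarrow> d | y # ys \<Rightarrow> y)" for d :: 'b and l i
    by (auto simp: nth_default_def Cons_nth_drop_Suc[symmetric])
  moreover have "computable (\<lambda>x. case rec_nat (l x) (\<lambda>_ l'. case l' of [] \<Rightarrow> [] | y # ys \<Rightarrow> ys) (i x) of
      [] \<Rightarrow> d x | y # ys \<Rightarrow> y)"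
    by (intro computable_intros assms)
  ultimately show ?thesis by simp
qed

lemma computable_ball [computable_intros]:
  assumes "computable l" "computable (\<lambda>z. P (fst z) (snd z))"
  shows "computable (\<lambda>x. \<forall>y\<in>set (l x). P x y)"
proof -
  have "foldr (\<lambda>y b. P x y \<and> b) l True \<longleftrightarrow> (\<forall>y\<in>set l. P x y)" for x l
    by (induction l) auto
  moreover have "computable (\<lambda>x. foldr (\<lambda>y b. P x y \<and> b) (l x) True)"
    by (intro computable_intros assms computable_lift2[OF assms(2)])
  ultimately show ?thesis by simp
qed

subsection \<open>Rational numbers\<close>

lemma computable_int_of_diff:
  assumes "computable f" "computable g"
  shows "computable (\<lambda>x. int (f x) - int (g x))"
proof (rule computable_lift2[OF _ assms])
  \<comment> \<open>\<open>int_decode\<close> maps \<open>2 * k\<close> to \<open>k\<close> and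
    \<open>2 * k + 1\<close> to \<open>- k - 1\<close>; the two branches are the resulting codes of
    a nonnegative and of a negative difference.\<close>
  let ?\<phi> = "\<lambda>p. if snd p \<le> fst p then (fst p - snd p) + (fst p - snd p)
    else Suc ((snd p - fst p - 1) + (snd p - fst p - 1)) :: nat"
  have "computable ?\<phi>" by (intro computable_intros)
  then obtain \<phi> where \<phi>: "recursive1 \<phi>" "\<And>c. \<phi> c = ?\<phi> (dec c)"
    by (elim computableE) (simp add: dec_nat_def)
  have "int_decode (?\<phi> p) = int (fst p) - int (snd p)" for p
    by (auto simp: int_decode_def sum_decode_def of_nat_diff simp flip: mult_2)
  then show "computable (\<lambda>p. int (fst p) - int (snd p))"
    by (intro computableI[OF \<phi>(1)]) (simp add: dec_int_def \<phi>(2))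
qed

text \<open>Quotient and remainder are computed together: the parity bit decides when the quotient
  grows.\<close>

lemma recursive1_half: "recursive1 (\<lambda>n. n div 2)" "recursive1 (\<lambda>n. n mod 2)"
proof -
  have "rec_nat (0, 0) (\<lambda>_ p. if snd p = 0 then (fst p, 1) else (Suc (fst p), 0)) n
      = (n div 2, n mod 2 :: nat)" for n :: nat
    by (induction n) (auto simp: div_Suc mod_Suc)
  moreover have "computable (\<lambda>n. rec_nat (0::nat, 0::nat)
      (\<lambda>_ p. if snd p = 0 then (fst p, 1) else (Suc (fst p), 0)) n)"
    by (intro computable_intros)
  ultimately have *: "computable (\<lambda>n. (n div 2, n mod 2 :: nat))" by simp
  show "recursive1 (\<lambda>n. n div 2)" "recursive1 (\<lambda>n. n mod 2)"
    using computable_fst[OF *] computable_snd[OF *]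
    unfolding computable_def dec_nat_def by (auto simp flip: fun_eq_iff)
qed

text \<open>Positive and negative parts reduce integer arithmetic to natural numbers: each operation
  becomes a difference of two naturals, to which \<open>computable_int_of_diff\<close>
  applies.\<close>

lemma
  computable_nat_int: "computable f \<Longrightarrow> computable (\<lambda>x. nat (f x))" and
  computable_nat_uminus_int: "computable f \<Longrightarrow> computable (\<lambda>x. nat (- f x))"
proof -
  note half = computable_comp[OF computable_recursive1[OF recursive1_half(1)]]
    computable_comp[OF computable_recursive1[OF recursive1_half(2)]]
  have "computable (\<lambda>n. if n mod 2 = 0 then n div 2 else 0 :: nat)"
    "computable (\<lambda>n. if n mod 2 = 0 then 0 else Suc (n div 2) :: nat)"
    by (intro computable_intros half)+
  note * = this
  from *(1) obtain \<phi> where \<phi>: "recursive1 \<phi>" "\<And>n. \<phi> n = (if n mod 2 = 0 then n div 2 else 0)"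
    by (rule computableE) (simp add: dec_nat_def)
  from *(2) obtain \<psi> where \<psi>: "recursive1 \<psi>"
      "\<And>n. \<psi> n = (if n mod 2 = 0 then 0 else Suc (n div 2))"
    by (rule computableE) (simp add: dec_nat_def)
  have "dec (\<phi> c) = nat (dec c :: int)" "dec (\<psi> c) = nat (- dec c :: int)" for c
    by (auto simp: \<phi> \<psi> dec_nat_def dec_int_def int_decode_def sum_decode_def even_iff_mod_2_eq_zero
      split: sum.split)
  with \<phi>(1) \<psi>(1) have "computable (\<lambda>z :: int. nat z)" "computable (\<lambda>z :: int. nat (- z))"
    by (blast intro: computableI)+
  from this[THEN computable_comp] show
    "computable f \<Longrightarrow> computable (\<lambda>x. nat (f x))" "computable f \<Longrightarrow> computable (\<lambda>x. nat (- f x))"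
    by blast+
qed

lemma computable_int [computable_intros]: "computable f \<Longrightarrow> computable (\<lambda>x. int (f x))"
  using computable_int_of_diff[OF _ computable_const, of f 0] by simp

lemma computable_add_int [computable_intros]:
  fixes f g :: "_ \<Rightarrow> int"
  assumes "computable f" "computable g" shows "computable (\<lambda>x. f x + g x)"
proof -
  have "computable (\<lambda>x. int (nat (f x) + nat (g x)) - int (nat (- f x) + nat (- g x)))"
    by (intro computable_int_of_diff computable_intros computable_nat_int computable_nat_uminus_int assms)
  moreover have "int (nat a + nat b) - int (nat (- a) + nat (- b)) = a + b" for a b by auto
  ultimately show ?thesis by simp
qed

lemma computable_mult_int [computable_intros]:
  fixes f g :: "_ \<Rightarrow> int"
  assumes "computable f" "computable g" shows "computable (\<lambda>x. f x * g x)"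
proof -
  have "computable (\<lambda>x. int (nat (f x) * nat (g x) + nat (- f x) * nat (- g x))
      - int (nat (f x) * nat (- g x) + nat (- f x) * nat (g x)))"
    by (intro computable_int_of_diff computable_intros computable_nat_int computable_nat_uminus_int assms)
  moreover have "int (nat a * nat b + nat (- a) * nat (- b)) - int (nat a * nat (- b) + nat (- a) * nat b)
    = a * b" for a b
    by (cases "a \<ge> 0"; cases "b \<ge> 0") auto
  ultimately show ?thesis by simp
qed

lemma computable_zero_int: "computable f \<Longrightarrow> computable (\<lambda>x. f x = (0 :: int))"
proof -
  assume "computable f"
  then have "computable (\<lambda>x. nat (f x) + nat (- f x) = 0)"
    by (intro computable_intros computable_nat_int computable_nat_uminus_int)
  moreover have "nat z + nat (- z) = 0 \<longleftrightarrow> z = 0" for z by auto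
  ultimately show ?thesis by simp
qed

definition fraction :: "int \<times> nat \<Rightarrow> rat" where
  "fraction p = Fract (fst p) (int (Suc (snd p)))"

lemma dec_rat: "dec c = fraction (dec c)"
  by (simp add: dec_rat_def decode_rat_def fraction_def dec_prod_def dec_int_def dec_nat_def
    split: prod.split)

lemma computable_fraction: "computable f \<Longrightarrow> computable (\<lambda>x. fraction (f x))"
  by (rule computable_comp, rule computableI[OF recursive1_id]) (simp_all add: dec_rat)

text \<open>A rational and the fraction presenting it share their code, so a realizer for fractions
  also serves for rationals.\<close>

lemma computable_on_rat: "computable (\<lambda>p. f (fraction p)) \<Longrightarrow> computable f"
  by (elim computableE) (rule computableI, auto simp: dec_rat)

lemma computable_on_rat2:
  assumes "computable (\<lambda>p. k (fraction (fst p)) (fraction (snd p)))" "computable f" "computable g"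
  shows "computable (\<lambda>x. k (f x) (g x))"
proof (rule computable_lift2[OF _ assms(2,3)])
  show "computable (\<lambda>p. k (fst p) (snd p))"
    using assms(1) by (elim computableE) (rule computableI, auto simp: dec_rat dec_prod_def)
qed

lemma computable_add_rat [computable_intros]:
  fixes f g :: "_ \<Rightarrow> rat"
  assumes "computable f" "computable g" shows "computable (\<lambda>x. f x + g x)"
proof (rule computable_on_rat2[OF _ assms])
  \<comment> \<open>Denominators are stored minus one, and
    \<open>Suc a * Suc b = Suc (a + b + a * b)\<close>. No reduction to lowest terms takes
    place.\<close>
  have "fraction p + fraction q = fraction (fst p * int (Suc (snd q)) + fst q * int (Suc (snd p)),
      snd p + snd q + snd p * snd q)" for p q
    by (simp add: fraction_def algebra_simps)
  then show "computable (\<lambda>p. fraction (fst p) + fraction (snd p))"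
    by (simp only:) (intro computable_fraction computable_intros)
qed

lemma computable_mult_rat [computable_intros]:
  fixes f g :: "_ \<Rightarrow> rat"
  assumes "computable f" "computable g" shows "computable (\<lambda>x. f x * g x)"
proof (rule computable_on_rat2[OF _ assms])
  have "fraction p * fraction q = fraction (fst p * fst q, snd p + snd q + snd p * snd q)" for p q
    unfolding fraction_def mult_rat by (simp add: algebra_simps)
  then show "computable (\<lambda>p. fraction (fst p) * fraction (snd p))"
    by (simp only:) (intro computable_fraction computable_intros)
qed

lemma computable_eq_rat [computable_intros]:
  fixes f g :: "_ \<Rightarrow> rat"
  assumes "computable f" "computable g" shows "computable (\<lambda>x. f x = g x)"
proof -
  have "fraction p = 0 \<longleftrightarrow> fst p = 0" for p
    by (simp add: fraction_def Zero_rat_def eq_rat)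
  then have "computable (\<lambda>p. fraction p = 0)"
    by (simp only:) (intro computable_zero_int computable_intros)
  then have "computable (\<lambda>r :: rat. r = 0)" by (rule computable_on_rat)
  moreover have "computable (\<lambda>x. f x + (-1) * g x)" by (intro computable_intros assms)
  ultimately have "computable (\<lambda>x. f x + (-1) * g x = 0)" by (rule computable_comp)
  then show ?thesis by simp
qed

subsection \<open>Semidecidable predicates\<close>

definition semidecidable :: "('a :: decodable \<Rightarrow> bool) \<Rightarrow> bool" where
  "semidecidable P \<longleftrightarrow> (\<exists>D. computable D \<and> (\<forall>x. P x \<longleftrightarrow> (\<exists>w :: nat. D (x, w))))"

lemma semidecidableE:
  assumes "semidecidable P"
  obtains D where "computable D" "\<And>x. P x \<longleftrightarrow> (\<exists>w :: nat. D (x, w))"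
  using assms unfolding semidecidable_def by blast

named_theorems semidecidable_intros

lemma semidecidable_computable:
  assumes "computable P" shows "semidecidable P"
  unfolding semidecidable_def
  by (rule exI[of _ "\<lambda>z. P (fst z)"])
    (auto intro!: computable_comp[OF assms] computable_intros)

lemma semidecidable_conj [semidecidable_intros]:
  assumes "semidecidable P" "semidecidable Q"
  shows "semidecidable (\<lambda>x. P x \<and> Q x)"
proof -
  obtain D E where DE: "computable D" "computable E" and
    PQ: "\<And>x. P x \<longleftrightarrow> (\<exists>w :: nat. D (x, w))" "\<And>x. Q x \<longleftrightarrow> (\<exists>w :: nat. E (x, w))"
    using assms by (elim semidecidableE) blast
  let ?DE = "\<lambda>z. D (fst z, fst (prod_decode (snd z))) \<and> E (fst z, snd (prod_decode (snd z)))"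
  have "computable ?DE"
    by (intro computable_conj computable_comp[OF DE(1)] computable_comp[OF DE(2)] computable_intros
        computable_comp[OF computable_recursive1[OF recursive1_fst_prod_decode]]
        computable_comp[OF computable_recursive1[OF recursive1_snd_prod_decode]])
  moreover have "(P x \<and> Q x) \<longleftrightarrow> (\<exists>w. ?DE (x, w))" for x
    by (auto simp: PQ) (metis fst_conv prod_encode_inverse snd_conv)
  ultimately show ?thesis unfolding semidecidable_def by blast
qed

lemma semidecidable_ex [semidecidable_intros]:
  assumes "semidecidable (\<lambda>z. P (fst z) (snd z))"
  shows "semidecidable (\<lambda>x. \<exists>y. P x y)"
proof -
  from assms obtain D where D: "computable D"
    and "\<And>z. (\<lambda>z. P (fst z) (snd z)) z \<longleftrightarrow> (\<exists>w :: nat. D (z, w))"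
    by (rule semidecidableE) (rule that)
  from this(2)[of "(_, _)"] have P: "P x y \<longleftrightarrow> (\<exists>w :: nat. D ((x, y), w))" for x y by simp
  let ?D = "\<lambda>z. D ((fst z, dec (fst (prod_decode (snd z)))), snd (prod_decode (snd z)))"
  have "computable ?D"
    by (intro computable_comp[OF D(1)] computable_intros computable_comp[OF computable_dec]
        computable_comp[OF computable_recursive1[OF recursive1_fst_prod_decode]]
        computable_comp[OF computable_recursive1[OF recursive1_snd_prod_decode]])
  moreover have "(\<exists>y. P x y) \<longleftrightarrow> (\<exists>w. ?D (x, w))" for x
    by (auto simp: P) (metis dec_ex fst_conv prod_encode_inverse snd_conv)
  ultimately show ?thesis unfolding semidecidable_def by blast
qed

text \<open>One number witnesses all conjuncts: a strict bound on the individual witnesses, below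
  which the search is finite.\<close>

lemma semidecidable_ball [semidecidable_intros]:
  assumes "semidecidable (\<lambda>z. P (fst z) (snd z))" "computable l"
  shows "semidecidable (\<lambda>x. \<forall>y\<in>set (l x). P x y)"
proof -
  from assms(1) obtain D where D: "computable D"
    and "\<And>z. (\<lambda>z. P (fst z) (snd z)) z \<longleftrightarrow> (\<exists>w :: nat. D (z, w))"
    by (rule semidecidableE) (rule that)
  from this(2)[of "(_, _)"] have P: "P x y \<longleftrightarrow> (\<exists>w :: nat. D ((x, y), w))" for x y by simp
  let ?D = "\<lambda>z. \<forall>y\<in>set (l (fst z)). \<exists>w<snd z. D ((fst z, y), w)"
  have "computable ?D"
    by (intro computable_intros computable_comp[OF assms(2)] computable_comp[OF D(1)])
  moreover have "(\<forall>y\<in>set (l x). P x y) \<longleftrightarrow> (\<exists>w. ?D (x, w))" for x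
  proof
    assume "\<forall>y\<in>set (l x). P x y"
    then obtain w where w: "\<forall>y\<in>set (l x). D ((x, y), w y)" by (metis P)
    have "\<forall>y\<in>set (l x). w y < Suc (Max (w ` set (l x)))" by (auto simp: less_Suc_eq_le)
    with w show "\<exists>w. ?D (x, w)" by (intro exI[of _ "Suc (Max (w ` set (l x)))"]) auto
  qed (auto simp: P)
  ultimately show ?thesis unfolding semidecidable_def by blast
qed

text \<open>The search runs over single numbers coding an output together with a witness, and the
  output part of the least success is returned. The result may depend on the code \<open>c\<close>
  and not only on \<open>dec c\<close>, which is harmless because \<open>P\<close> may have many
  solutions.\<close>

lemma semidecidable_uniformize:
  fixes P :: "'a :: decodable \<times> 'b :: decodable \<Rightarrow> bool"
  assumes "semidecidable P"
  shows "\<exists>r. \<forall>c. (\<exists>y. P (dec c, y)) \<longrightarrow> (\<exists>out. rec_eval r [c] out \<and> P (dec c, dec out))"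
proof -
  obtain D where D: "computable D" and P: "\<And>z. P z \<longleftrightarrow> (\<exists>w :: nat. D (z, w))"
    using assms by (elim semidecidableE) blast
  let ?D = "\<lambda>z. D ((dec (snd z), dec (fst (prod_decode (fst z)))), snd (prod_decode (fst z)))"
  have "computable ?D"
    by (intro computable_comp[OF D(1)] computable_intros computable_comp[OF computable_dec]
        computable_comp[OF computable_recursive1[OF recursive1_fst_prod_decode]]
        computable_comp[OF computable_recursive1[OF recursive1_snd_prod_decode]])
  then obtain \<delta> where \<delta>: "recursive1 \<delta>" "\<And>c. \<delta> c = 0 \<longleftrightarrow> ?D (dec c)"
    by (elim computableE) (simp add: dec_bool_def)
  have "recursive2 (\<lambda>s c. \<delta> (prod_encode (s, c)))"
    by (intro recursive2_comp[OF \<delta>(1)] recursive2_prod_encode)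
  then obtain r where r: "\<And>s c. rec_eval r [s, c] (\<delta> (prod_encode (s, c)))"
    unfolding recursive2_def by blast
  obtain p where p: "\<And>c. rec_eval p [c] (fst (prod_decode c))"
    using recursive1_fst_prod_decode unfolding recursive1_def by blast
  have "\<exists>out. rec_eval (Comp p [Mu r]) [c] out \<and> P (dec c, dec out)" if y: "P (dec c, y)" for c y
  proof -
    from y obtain w where "D ((dec c, y), w)" by (auto simp: P)
    then have "\<exists>s. \<delta> (prod_encode (s, c)) = 0"
      using dec_ex[of y]
      by (auto simp: \<delta>(2) dec_nat_def) (metis fst_conv prod_encode_inverse snd_conv)
    then have s: "\<delta> (prod_encode (LEAST s. \<delta> (prod_encode (s, c)) = 0, c)) = 0" (is "\<delta> (prod_encode (?s, c)) = 0")
      by (rule LeastI_ex)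
    have "rec_eval (Mu r) [c] ?s"
    proof (rule rec_eval.Mu)
      show "rec_eval r [?s, c] 0" using r[of ?s c] s by simp
      have "\<delta> (prod_encode (m, c)) \<noteq> 0" if "m < ?s" for m
        using that by (rule not_less_Least)
      then show "\<forall>m<?s. \<exists>y. rec_eval r [m, c] (Suc y)"
        using r by (metis old.nat.exhaust)
    qed
    then have "rec_eval (Comp p [Mu r]) [c] (fst (prod_decode ?s))"
      using p by (rule rec_eval_Comp1)
    moreover from s have "P (dec c, dec (fst (prod_decode ?s)))"
      by (auto simp: \<delta>(2) P dec_nat_def)
    ultimately show ?thesis by blast
  qed
  then show ?thesis by blast
qed

section \<open>Evaluation of polynomials\<close>

text \<open>The step carries no side conditions: \<open>c\<close> may be 0 and \<open>m\<close> may
  already occur in \<open>p\<close>. This is enough for additive properties and keeps every use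
  short.\<close>

lemma poly_mapping_add_induct [case_names zero add]:
  assumes "P 0" and "\<And>m c p. P p \<Longrightarrow> P (Poly_Mapping.single m c + p)"
  shows "P (p :: 'a \<Rightarrow>\<^sub>0 'b :: comm_monoid_add)"
proof -
  have "P (\<Sum>m\<in>A. Poly_Mapping.single m (Poly_Mapping.lookup p m))" if "finite A" for A
    using that by induction (auto intro: assms)
  moreover have "(\<Sum>m\<in>Poly_Mapping.keys p. Poly_Mapping.single m (Poly_Mapping.lookup p m)) = p"
    by (rule poly_mapping_eqI) (simp add: lookup_sum lookup_single when_def in_keys_iff)
  ultimately show ?thesis by (metis finite_keys)
qed

definition monom_value :: "(nat \<Rightarrow> 'a) \<Rightarrow> (nat \<Rightarrow>\<^sub>0 nat) \<Rightarrow> 'a :: comm_semiring_1" where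
  "monom_value v m = (\<Prod>i\<in>Poly_Mapping.keys m. v i ^ Poly_Mapping.lookup m i)"

text \<open>Evaluation under a valuation of all variables is a ring homomorphism without conditions
  relating the polynomial to the length of a point.\<close>

definition poly_value :: "(nat \<Rightarrow> 'a) \<Rightarrow> 'a mpoly \<Rightarrow> 'a :: comm_semiring_1" where
  "poly_value v p = (\<Sum>m\<in>Poly_Mapping.keys p. Poly_Mapping.lookup p m * monom_value v m)"

lemma eval_poly_conv_poly_value: "eval_poly p x = poly_value ((!) x) p"
  by (simp add: eval_poly_def poly_value_def monom_value_def)

lemma monom_value_superset:
  assumes "finite A" "Poly_Mapping.keys m \<subseteq> A"
  shows "monom_value v m = (\<Prod>i\<in>A. v i ^ Poly_Mapping.lookup m i)"
  unfolding monom_value_def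
  by (rule prod.mono_neutral_left) (use assms in \<open>auto simp: in_keys_iff\<close>)

lemma monom_value_0 [simp]: "monom_value v 0 = 1"
  by (simp add: monom_value_def)

lemma monom_value_add: "monom_value v (m + n) = monom_value v m * monom_value v n"
proof -
  let ?A = "Poly_Mapping.keys m \<union> Poly_Mapping.keys n"
  have "monom_value v (m + n) = (\<Prod>i\<in>?A. v i ^ Poly_Mapping.lookup (m + n) i)"
    by (rule monom_value_superset) (auto simp: in_keys_iff lookup_add)
  also have "\<dots> = monom_value v m * monom_value v n"
    by (simp add: monom_value_superset[of ?A] lookup_add power_add prod.distrib)
  finally show ?thesis .
qed

lemma poly_value_superset:
  assumes "finite A" "Poly_Mapping.keys p \<subseteq> A"
  shows "poly_value v p = (\<Sum>m\<in>A. Poly_Mapping.lookup p m * monom_value v m)"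
  unfolding poly_value_def
  by (rule sum.mono_neutral_left) (use assms in \<open>auto simp: in_keys_iff\<close>)

lemma poly_value_0 [simp]: "poly_value v 0 = 0"
  by (simp add: poly_value_def)

lemma poly_value_single [simp]: "poly_value v (Poly_Mapping.single m c) = c * monom_value v m"
  by (simp add: poly_value_def)

lemma poly_value_1 [simp]: "poly_value v 1 = 1"
  by (metis monom_value_0 mult_1 poly_value_single single_one)

lemma poly_value_add [simp]: "poly_value v (p + q) = poly_value v p + poly_value v q"
proof -
  let ?A = "Poly_Mapping.keys p \<union> Poly_Mapping.keys q"
  have "poly_value v (p + q) = (\<Sum>m\<in>?A. Poly_Mapping.lookup (p + q) m * monom_value v m)"
    by (rule poly_value_superset) (auto simp: in_keys_iff lookup_add)
  also have "\<dots> = poly_value v p + poly_value v q"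
    by (simp add: poly_value_superset[of ?A] lookup_add distrib_right sum.distrib)
  finally show ?thesis .
qed

lemma poly_value_mult [simp]: "poly_value v (p * q) = poly_value v p * poly_value v q"
proof -
  have *: "poly_value v (Poly_Mapping.single m c * q) = c * monom_value v m * poly_value v q" for m c
    by (induction q rule: poly_mapping_add_induct)
      (simp_all add: distrib_left mult_single monom_value_add mult_ac)
  show ?thesis
    by (induction p rule: poly_mapping_add_induct) (simp_all add: distrib_right *)
qed

lemma poly_value_sum [simp]: "poly_value v (sum f A) = (\<Sum>x\<in>A. poly_value v (f x))"
  by (induction A rule: infinite_finite_induct) simp_all

lemma poly_value_power [simp]: "poly_value v (p ^ k) = poly_value v p ^ k"
  by (induction k) simp_all

lemma poly_value_prod_list [simp]: "poly_value v (prod_list ps) = prod_list (map (poly_value v) ps)"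
  by (induction ps) simp_all

lemma poly_value_const_0:
  fixes p :: "'a :: comm_semiring_1 mpoly"
  shows "poly_value (\<lambda>_. 0) p = Poly_Mapping.lookup p 0"
proof (induction p rule: poly_mapping_add_induct)
  case (add m c p)
  have "monom_value (\<lambda>_. 0) m = (1 when m = 0 :: 'a)"
  proof (cases "m = 0")
    case False
    then obtain i where "i \<in> Poly_Mapping.keys m" by fastforce
    moreover from this have "(0 :: 'a) ^ Poly_Mapping.lookup m i = 0"
      by (simp add: in_keys_iff zero_power)
    ultimately have "monom_value (\<lambda>_. 0) m = (0 :: 'a)"
      unfolding monom_value_def by (blast intro: prod_zero finite_keys)
    with False show ?thesis by simp
  qed simp
  with add show ?case by (auto simp: lookup_add lookup_single when_def)
qed simp

lemma poly_value_cong: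
  assumes "p \<in> polys_in n" "\<And>i. i < n \<Longrightarrow> v i = w i"
  shows "poly_value v p = poly_value w p"
  unfolding poly_value_def monom_value_def
  by (intro sum.cong refl arg_cong2[of _ _ _ _ "(*)"] prod.cong arg_cong2[of _ _ _ _ "(^)"] assms(2))
    (use assms(1) in \<open>auto simp: polys_in_def vars_def\<close>)

text \<open>Padding by zeros only affects variables that do not occur; it makes a list into a
  valuation of all variables.\<close>

lemma eval_poly_nth_default:
  "p \<in> polys_in (length x) \<Longrightarrow> eval_poly p x = poly_value (nth_default 0 x) p"
  unfolding eval_poly_conv_poly_value by (rule poly_value_cong) (auto simp: nth_default_nth)

lemma lookup_complex_poly [simp]:
  "Poly_Mapping.lookup (complex_poly p) m = of_rat (Poly_Mapping.lookup p m)"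
  by (simp add: complex_poly_def map.rep_eq when_def)

lemma keys_complex_poly [simp]: "Poly_Mapping.keys (complex_poly p) = Poly_Mapping.keys p"
  by (auto simp: in_keys_iff)

lemma complex_poly_in_polys_in [simp]: "complex_poly p \<in> polys_in n \<longleftrightarrow> p \<in> polys_in n"
  by (simp add: polys_in_def vars_def)

lemma complex_poly_0 [simp]: "complex_poly 0 = 0"
  by (rule poly_mapping_eqI) simp

lemma complex_poly_add: "complex_poly (p + q) = complex_poly p + complex_poly q"
  by (rule poly_mapping_eqI) (simp add: lookup_add of_rat_add)

lemma complex_poly_single: "complex_poly (Poly_Mapping.single m c) = Poly_Mapping.single m (of_rat c)"
  by (rule poly_mapping_eqI) (simp add: lookup_single when_def)

lemma complex_poly_mult: "complex_poly (p * q) = complex_poly p * complex_poly q"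
proof -
  have *: "complex_poly (Poly_Mapping.single m c * q) = Poly_Mapping.single m (of_rat c) * complex_poly q" for m c
    by (induction q rule: poly_mapping_add_induct)
      (simp_all add: distrib_left mult_single complex_poly_add complex_poly_single of_rat_mult)
  show ?thesis
    by (induction p rule: poly_mapping_add_induct)
      (simp_all add: distrib_right complex_poly_add complex_poly_single *)
qed

lemma complex_poly_1 [simp]: "complex_poly 1 = 1"
  by (rule poly_mapping_eqI) (simp add: lookup_one when_def)

lemma complex_poly_prod_list: "complex_poly (prod_list ps) = prod_list (map complex_poly ps)"
  by (induction ps) (simp_all add: complex_poly_mult)

lemma monom_value_of_rat:
  "monom_value (\<lambda>i. of_rat (v i) :: complex) m = of_rat (monom_value v m)"
  by (simp add: monom_value_def of_rat_prod of_rat_power)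

lemma poly_value_complex_poly:
  "poly_value (\<lambda>i. of_rat (v i)) (complex_poly p) = of_rat (poly_value v p)"
  by (simp add: poly_value_def monom_value_of_rat of_rat_sum of_rat_mult)

lemma eval_complex_poly:
  assumes "p \<in> polys_in (length x)"
  shows "eval_poly (complex_poly p) (map of_rat x) = of_rat (eval_poly p x)"
proof -
  have "eval_poly (complex_poly p) (map of_rat x) = poly_value (\<lambda>i. of_rat (x ! i)) (complex_poly p)"
    unfolding eval_poly_conv_poly_value using assms by (intro poly_value_cong) auto
  also have "\<dots> = of_rat (eval_poly p x)"
    by (simp add: poly_value_complex_poly eval_poly_conv_poly_value)
  finally show ?thesis .
qed

lemma zero_in_polys_in [simp]: "0 \<in> polys_in n"
  by (simp add: polys_in_def vars_def)

lemma single_in_polys_in: "Poly_Mapping.keys m \<subseteq> {..<n} \<Longrightarrow> Poly_Mapping.single m c \<in> polys_in n"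
  by (auto simp: polys_in_def vars_def)

lemma const_in_polys_in [simp]: "Poly_Mapping.single 0 c \<in> polys_in n"
  by (rule single_in_polys_in) simp

lemma one_in_polys_in [simp]: "1 \<in> polys_in n"
  by (metis const_in_polys_in single_one)

lemma add_in_polys_in: "p \<in> polys_in n \<Longrightarrow> q \<in> polys_in n \<Longrightarrow> p + q \<in> polys_in n"
  using keys_add[of p q] by (fastforce simp: polys_in_def vars_def)

lemma in_polys_in_iff:
  "p \<in> polys_in n \<longleftrightarrow> (\<forall>m\<in>Poly_Mapping.keys p. Poly_Mapping.keys m \<subseteq> {..<n})"
  by (auto simp: polys_in_def vars_def)

lemma mult_in_polys_in:
  assumes "p \<in> polys_in n" "q \<in> polys_in n"
  shows "p * q \<in> polys_in n"
  unfolding in_polys_in_iff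
proof
  fix m assume "m \<in> Poly_Mapping.keys (p * q)"
  then obtain a b where "m = a + b" "a \<in> Poly_Mapping.keys p" "b \<in> Poly_Mapping.keys q"
    using keys_mult[of p q] by blast
  with assms keys_add[of a b] show "Poly_Mapping.keys m \<subseteq> {..<n}"
    unfolding in_polys_in_iff by blast
qed

lemma minus_in_polys_in:
  assumes "p \<in> polys_in n" "(q :: 'a :: comm_ring_1 mpoly) \<in> polys_in n"
  shows "p - q \<in> polys_in n"
  using assms keys_diff[of p q] by (fastforce simp: polys_in_def vars_def)

lemma power_in_polys_in: "p \<in> polys_in n \<Longrightarrow> p ^ k \<in> polys_in n"
  by (induction k) (auto intro: mult_in_polys_in)

lemma prod_list_in_polys_in: "set ps \<subseteq> polys_in n \<Longrightarrow> prod_list ps \<in> polys_in n"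
  by (induction ps) (auto intro: mult_in_polys_in)

section \<open>Polynomials as lists of terms\<close>

text \<open>The format is that of the prescribed codes of polynomials, so decoding needs no
  conversion. Lists are never normalized; equality of polynomials is tested through
  coefficients.\<close>

type_synonym terms = "(rat \<times> nat list) list"

definition poly_of_terms :: "terms \<Rightarrow> rat mpoly" where
  "poly_of_terms p = sum_list (map (\<lambda>t. Poly_Mapping.single (Poly_Mapping.nth (snd t)) (fst t)) p)"

lemma decode_poly_conv_dec: "decode_poly c = poly_of_terms (dec c)"
proof -
  have "decode_term d = (\<lambda>t. Poly_Mapping.single (Poly_Mapping.nth (snd t)) (fst t)) (dec d)" for d
    by (simp add: decode_term_def dec_prod_def dec_rat_def decode_monomial_def dec_list_def
        decode_list_def dec_nat_def[abs_def] split: prod.split)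
  then have "decode_term = (\<lambda>d. (\<lambda>t. Poly_Mapping.single (Poly_Mapping.nth (snd t)) (fst t)) (dec d))"
    by (rule ext)
  then show ?thesis
    by (simp add: decode_poly_def poly_of_terms_def dec_list_def decode_list_def o_def)
qed

lemma decode_list_conv_dec: "(\<And>c. d c = f (dec c)) \<Longrightarrow> decode_list d c = map f (dec c)"
  by (simp add: decode_list_def dec_list_def)

lemma surj_poly_of_terms: "\<exists>t. p = poly_of_terms t"
  using surj_decode_poly by (metis decode_poly_conv_dec surj_def)

lemma poly_of_terms_Nil [simp]: "poly_of_terms [] = 0"
  by (simp add: poly_of_terms_def)

lemma poly_of_terms_Cons [simp]:
  "poly_of_terms (t # p) = Poly_Mapping.single (Poly_Mapping.nth (snd t)) (fst t) + poly_of_terms p"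
  by (simp add: poly_of_terms_def)

lemma poly_of_terms_append [simp]: "poly_of_terms (p @ q) = poly_of_terms p + poly_of_terms q"
  by (induction p) (simp_all add: add_ac)

text \<open>The sum of the lengths is a simple bound for both of them; trailing zeros do not change
  the monomial.\<close>

definition add_exps :: "nat list \<Rightarrow> nat list \<Rightarrow> nat list" where
  "add_exps d e = map (\<lambda>i. nth_default 0 d i + nth_default 0 e i) [0..<length d + length e]"

lemma nth_add_exps: "Poly_Mapping.nth (add_exps d e) = Poly_Mapping.nth d + Poly_Mapping.nth e"
  by (rule poly_mapping_eqI) (auto simp: lookup_add add_exps_def nth_default_def)

definition mul_terms :: "terms \<Rightarrow> terms \<Rightarrow> terms" where
  "mul_terms p q =
    concat (map (\<lambda>s. map (\<lambda>t. (fst s * fst t, add_exps (snd s) (snd t))) q) p)"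

lemma poly_of_mul_terms [simp]:
  "poly_of_terms (mul_terms p q) = poly_of_terms p * poly_of_terms q"
proof (induction p)
  case (Cons s p)
  have "poly_of_terms (map (\<lambda>t. (fst s * fst t, add_exps (snd s) (snd t))) q)
      = Poly_Mapping.single (Poly_Mapping.nth (snd s)) (fst s) * poly_of_terms q"
    by (induction q) (simp_all add: distrib_left mult_single nth_add_exps)
  with Cons show ?case by (simp add: mul_terms_def distrib_right)
qed (simp add: mul_terms_def)

definition const_terms :: "rat \<Rightarrow> terms" where
  "const_terms c = [(c, [])]"

lemma poly_of_const_terms [simp]: "poly_of_terms (const_terms c) = Poly_Mapping.single 0 c"
  by (simp add: const_terms_def)

definition prod_terms :: "terms list \<Rightarrow> terms" where
  "prod_terms ps = foldr mul_terms ps (const_terms 1)"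

lemma poly_of_prod_terms [simp]:
  "poly_of_terms (prod_terms ps) = prod_list (map poly_of_terms ps)"
  by (induction ps) (simp_all add: prod_terms_def)

definition power_terms :: "terms \<Rightarrow> nat \<Rightarrow> terms" where
  "power_terms p k = rec_nat (const_terms 1) (\<lambda>_. mul_terms p) k"

lemma poly_of_power_terms [simp]: "poly_of_terms (power_terms p k) = poly_of_terms p ^ k"
  by (induction k) (simp_all add: power_terms_def)

text \<open>A variable without an entry in \<open>fs\<close> is replaced by \<open>[]\<close>, the
  zero polynomial, in agreement with the padding of points by zeros.\<close>

definition subst_monom :: "nat list \<Rightarrow> terms list \<Rightarrow> terms" where
  "subst_monom e fs = prod_terms
    (map (\<lambda>i. power_terms (nth_default [] fs i) (nth_default 0 e i)) [0..<length e])"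

definition subst_terms :: "terms \<Rightarrow> terms list \<Rightarrow> terms" where
  "subst_terms p fs =
    concat (map (\<lambda>t. mul_terms (const_terms (fst t)) (subst_monom (snd t) fs)) p)"

lemma monom_value_nth:
  "monom_value v (Poly_Mapping.nth e) = prod_list (map (\<lambda>i. v i ^ nth_default 0 e i) [0..<length e])"
proof -
  have "Poly_Mapping.keys (Poly_Mapping.nth e) \<subseteq> {0..<length e}"
    by (auto simp: in_keys_iff nth_default_def simp del: keys_nth split: if_splits)
  then have "monom_value v (Poly_Mapping.nth e) = (\<Prod>i\<in>set [0..<length e]. v i ^ nth_default 0 e i)"
    by (simp add: monom_value_superset[of "{0..<length e}"] del: keys_nth)
  then show ?thesis by (simp only: prod.distinct_set_conv_list[OF distinct_upt])
qed

lemma poly_value_subst_terms: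
  "poly_value v (poly_of_terms (subst_terms p fs)) =
    poly_value (\<lambda>i. poly_value v (poly_of_terms (nth_default [] fs i))) (poly_of_terms p)"
  by (induction p)
    (simp_all add: subst_terms_def subst_monom_def monom_value_nth o_def)

lemma subst_terms_in_polys_in:
  assumes "\<And>f. f \<in> set fs \<Longrightarrow> poly_of_terms f \<in> polys_in n"
  shows "poly_of_terms (subst_terms p fs) \<in> polys_in n"
proof -
  have "poly_of_terms (nth_default [] fs i) \<in> polys_in n" for i
    using assms by (auto simp: nth_default_def)
  then have "poly_of_terms (subst_monom e fs) \<in> polys_in n" for e
    by (auto simp: subst_monom_def intro!: prod_list_in_polys_in power_in_polys_in)
  then show ?thesis
    by (induction p) (auto simp: subst_terms_def intro!: add_in_polys_in mult_in_polys_in)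
qed

definition same_exps :: "nat list \<Rightarrow> nat list \<Rightarrow> bool" where
  "same_exps d e \<longleftrightarrow> (\<forall>i<length d + length e. nth_default 0 d i = nth_default 0 e i)"

lemma same_exps_iff: "same_exps d e \<longleftrightarrow> Poly_Mapping.nth d = Poly_Mapping.nth e"
proof
  assume same: "same_exps d e"
  have "nth_default 0 d i = nth_default 0 e i" for i
    using same by (cases "i < length d + length e") (auto simp: same_exps_def nth_default_beyond)
  then show "Poly_Mapping.nth d = Poly_Mapping.nth e"
    by (intro poly_mapping_eqI) simp
qed (auto simp: same_exps_def simp flip: lookup_nth)

definition coeff_terms :: "terms \<Rightarrow> nat list \<Rightarrow> rat" where
  "coeff_terms p e = foldr (\<lambda>t s. (if same_exps (snd t) e then fst t else 0) + s) p 0"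

lemma coeff_terms: "coeff_terms p e = Poly_Mapping.lookup (poly_of_terms p) (Poly_Mapping.nth e)"
  by (induction p) (auto simp: coeff_terms_def same_exps_iff lookup_add lookup_single when_def)

definition eq_terms :: "terms \<Rightarrow> terms \<Rightarrow> bool" where
  "eq_terms p q \<longleftrightarrow> (\<forall>t\<in>set (p @ q). coeff_terms p (snd t) = coeff_terms q (snd t))"

text \<open>A coefficient can be nonzero only at a monomial listed in one of the two lists, so
  finitely many comparisons settle equality.\<close>

lemma eq_terms_iff: "eq_terms p q \<longleftrightarrow> poly_of_terms p = poly_of_terms q"
proof
  assume eq: "eq_terms p q"
  have out: "Poly_Mapping.lookup (poly_of_terms r) m = 0" if "\<forall>t\<in>set r. m \<noteq> Poly_Mapping.nth (snd t)" for r m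
    using that by (induction r) (auto simp: lookup_add lookup_single when_def)
  show "poly_of_terms p = poly_of_terms q"
  proof (rule poly_mapping_eqI)
    fix m
    show "Poly_Mapping.lookup (poly_of_terms p) m = Poly_Mapping.lookup (poly_of_terms q) m"
    proof (cases "\<exists>t\<in>set (p @ q). m = Poly_Mapping.nth (snd t)")
      case True
      with eq show ?thesis by (auto simp: eq_terms_def coeff_terms)
    next
      case False
      then show ?thesis using out[of p m] out[of q m] by auto
    qed
  qed
qed (simp add: eq_terms_def coeff_terms)

definition eval_terms :: "terms \<Rightarrow> rat list \<Rightarrow> rat" where
  "eval_terms p x = coeff_terms (subst_terms p (map const_terms x)) []"

text \<open>A constant coefficient is a value at the origin, so substituting constants evaluates.\<close>

lemma eval_terms: "eval_terms p x = poly_value (nth_default 0 x) (poly_of_terms p)"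
proof -
  have "eval_terms p x = poly_value (\<lambda>_. 0) (poly_of_terms (subst_terms p (map const_terms x)))"
    by (simp add: eval_terms_def coeff_terms poly_value_const_0)
  also have "\<dots> = poly_value (\<lambda>i. poly_value (\<lambda>_. 0)
      (poly_of_terms (nth_default [] (map const_terms x) i))) (poly_of_terms p)"
    by (rule poly_value_subst_terms)
  also have "(\<lambda>i. poly_value (\<lambda>_. 0) (poly_of_terms (nth_default [] (map const_terms x) i)))
      = nth_default 0 x"
    by (auto simp: fun_eq_iff nth_default_def)
  finally show ?thesis .
qed

text \<open>The list \<open>us\<close> is a certificate of ideal membership: cofactors paired with
  indices of generators. An index out of range contributes 0, so every list is a legitimate
  certificate.\<close>

definition comb_terms :: "(terms \<times> nat) list \<Rightarrow> terms list \<Rightarrow> terms" where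
  "comb_terms us ps = concat (map (\<lambda>u. mul_terms (fst u) (nth_default [] ps (snd u))) us)"

definition lin_comb_terms :: "(rat \<times> nat) list \<Rightarrow> terms list \<Rightarrow> terms" where
  "lin_comb_terms cs ps = comb_terms (map (\<lambda>c. (const_terms (fst c), snd c)) cs) ps"

section \<open>Computability of the operations on lists of terms\<close>

lemma computable_add_exps [computable_intros]:
  "computable f \<Longrightarrow> computable g \<Longrightarrow> computable (\<lambda>x. add_exps (f x) (g x))"
  by (rule computable_lift2) (unfold add_exps_def, intro computable_intros)

lemma computable_mul_terms [computable_intros]:
  "computable f \<Longrightarrow> computable g \<Longrightarrow> computable (\<lambda>x. mul_terms (f x) (g x))"
  by (rule computable_lift2) (unfold mul_terms_def, intro computable_intros)

lemma computable_const_terms [computable_intros]: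
  "computable f \<Longrightarrow> computable (\<lambda>x. const_terms (f x))"
  unfolding const_terms_def by (intro computable_intros)

lemma computable_prod_terms [computable_intros]:
  "computable f \<Longrightarrow> computable (\<lambda>x. prod_terms (f x))"
  unfolding prod_terms_def by (intro computable_intros)

lemma computable_power_terms [computable_intros]:
  "computable f \<Longrightarrow> computable g \<Longrightarrow> computable (\<lambda>x. power_terms (f x) (g x))"
  by (rule computable_lift2) (unfold power_terms_def, intro computable_intros)

lemma computable_subst_monom [computable_intros]:
  "computable f \<Longrightarrow> computable g \<Longrightarrow> computable (\<lambda>x. subst_monom (f x) (g x))"
  by (rule computable_lift2) (unfold subst_monom_def, intro computable_intros)

lemma computable_subst_terms [computable_intros]:
  "computable f \<Longrightarrow> computable g \<Longrightarrow> computable (\<lambda>x. subst_terms (f x) (g x))"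
  by (rule computable_lift2) (unfold subst_terms_def, intro computable_intros)

lemma computable_same_exps [computable_intros]:
  "computable f \<Longrightarrow> computable g \<Longrightarrow> computable (\<lambda>x. same_exps (f x) (g x))"
  by (rule computable_lift2) (unfold same_exps_def, intro computable_intros)

lemma computable_coeff_terms [computable_intros]:
  "computable f \<Longrightarrow> computable g \<Longrightarrow> computable (\<lambda>x. coeff_terms (f x) (g x))"
  by (rule computable_lift2) (unfold coeff_terms_def, intro computable_intros)

lemma computable_eq_terms [computable_intros]:
  "computable f \<Longrightarrow> computable g \<Longrightarrow> computable (\<lambda>x. eq_terms (f x) (g x))"
  by (rule computable_lift2) (unfold eq_terms_def, intro computable_intros)

lemma computable_eval_terms [computable_intros]:
  "computable f \<Longrightarrow> computable g \<Longrightarrow> computable (\<lambda>x. eval_terms (f x) (g x))"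
  by (rule computable_lift2) (unfold eval_terms_def, intro computable_intros)

lemma computable_comb_terms [computable_intros]:
  "computable f \<Longrightarrow> computable g \<Longrightarrow> computable (\<lambda>x. comb_terms (f x) (g x))"
  by (rule computable_lift2) (unfold comb_terms_def, intro computable_intros)

lemma computable_lin_comb_terms [computable_intros]:
  "computable f \<Longrightarrow> computable g \<Longrightarrow> computable (\<lambda>x. lin_comb_terms (f x) (g x))"
  by (rule computable_lift2) (unfold lin_comb_terms_def, intro computable_intros)

section \<open>Hilbert's basis theorem\<close>

text \<open>Rings are subsets of a type because the polynomial rings in all finite numbers of
  variables live in the same type, whose own ring has infinitely many variables and is not
  noetherian.\<close>

definition is_subring :: "'a :: comm_ring_1 set \<Rightarrow> bool" where
  "is_subring A \<longleftrightarrow> 1 \<in> A \<and> (\<forall>x\<in>A. \<forall>y\<in>A. x - y \<in> A \<and> x * y \<in> A)"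

definition is_ideal :: "'a :: comm_ring_1 set \<Rightarrow> 'a set \<Rightarrow> bool" where
  "is_ideal A I \<longleftrightarrow> I \<subseteq> A \<and> 0 \<in> I \<and> (\<forall>x\<in>I. \<forall>y\<in>I. x + y \<in> I) \<and> (\<forall>a\<in>A. \<forall>x\<in>I. a * x \<in> I)"

text \<open>The derivation of membership has the shape of a list of cofactors, which
  \<open>ideal_gen_comb_terms\<close> extracts from it.\<close>

inductive_set ideal_gen :: "'a :: comm_ring_1 set \<Rightarrow> 'a set \<Rightarrow> 'a set" for A G where
  zero: "0 \<in> ideal_gen A G"
| step: "r \<in> A \<Longrightarrow> g \<in> G \<Longrightarrow> p \<in> ideal_gen A G \<Longrightarrow> r * g + p \<in> ideal_gen A G"

definition noetherian :: "'a :: comm_ring_1 set \<Rightarrow> bool" where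
  "noetherian A \<longleftrightarrow> (\<forall>I. is_ideal A I \<longrightarrow> (\<exists>G. finite G \<and> G \<subseteq> I \<and> I \<subseteq> ideal_gen A G))"

lemma subring_closed:
  assumes "is_subring A"
  shows "1 \<in> A" "0 \<in> A"
    "x \<in> A \<Longrightarrow> y \<in> A \<Longrightarrow> x - y \<in> A" "x \<in> A \<Longrightarrow> y \<in> A \<Longrightarrow> x + y \<in> A"
    "x \<in> A \<Longrightarrow> y \<in> A \<Longrightarrow> x * y \<in> A" "x \<in> A \<Longrightarrow> - x \<in> A"
proof -
  show one: "1 \<in> A" and minus: "\<And>x y. x \<in> A \<Longrightarrow> y \<in> A \<Longrightarrow> x - y \<in> A"
    and "x \<in> A \<Longrightarrow> y \<in> A \<Longrightarrow> x * y \<in> A"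
    using assms unfolding is_subring_def by auto
  show zero: "0 \<in> A" using minus[OF one one] by simp
  show uminus: "- x \<in> A" if "x \<in> A" for x using minus[OF zero that] by simp
  show "x + y \<in> A" if "x \<in> A" "y \<in> A" using minus[OF that(1) uminus[OF that(2)]] by simp
qed

lemma ideal_gen_add: "p \<in> ideal_gen A G \<Longrightarrow> q \<in> ideal_gen A G \<Longrightarrow> p + q \<in> ideal_gen A G"
  by (induction rule: ideal_gen.induct) (auto simp: add.assoc intro: ideal_gen.step)

lemma ideal_gen_mult:
  assumes "is_subring A" "a \<in> A" "p \<in> ideal_gen A G"
  shows "a * p \<in> ideal_gen A G"
  using assms(3)
proof induction
  case (step r g p)
  then have "(a * r) * g + a * p \<in> ideal_gen A G"
    by (intro ideal_gen.step subring_closed(5)[OF assms(1,2)])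
  then show ?case by (simp add: algebra_simps)
qed (simp add: ideal_gen.zero)

lemma ideal_gen_subset:
  assumes "is_ideal A I" "G \<subseteq> I"
  shows "ideal_gen A G \<subseteq> I"
proof
  fix p assume "p \<in> ideal_gen A G"
  then show "p \<in> I"
    by induction (use assms in \<open>auto simp: is_ideal_def subset_iff\<close>)
qed

text \<open>Expressions in \<open>x\<close> of degree less than \<open>d\<close> with coefficients
  in \<open>A\<close>. As \<open>x\<close> is arbitrary, such an expression may not be unique;
  degree is therefore an index of a set and not a function of the element.\<close>

fun adjoin_below :: "'a :: comm_ring_1 set \<Rightarrow> 'a \<Rightarrow> nat \<Rightarrow> 'a set" where
  "adjoin_below A x 0 = {0}"
| "adjoin_below A x (Suc d) = {a * x ^ d + p | a p. a \<in> A \<and> p \<in> adjoin_below A x d}"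

definition adjoin :: "'a :: comm_ring_1 set \<Rightarrow> 'a \<Rightarrow> 'a set" where
  "adjoin A x = (\<Union>d. adjoin_below A x d)"

context
  fixes A :: "'a :: comm_ring_1 set" and x :: 'a
  assumes A: "is_subring A"
begin

lemma adjoin_below_SucI:
  "a \<in> A \<Longrightarrow> p \<in> adjoin_below A x d \<Longrightarrow> a * x ^ d + p \<in> adjoin_below A x (Suc d)"
  by auto

lemma adjoin_below_mono: "d \<le> e \<Longrightarrow> adjoin_below A x d \<subseteq> adjoin_below A x e"
proof (induction rule: dec_induct)
  case (step e)
  have "adjoin_below A x e \<subseteq> adjoin_below A x (Suc e)"
    using adjoin_below_SucI[OF subring_closed(2)[OF A]] by fastforce
  with step show ?case by blast
qed simp

lemma adjoin_below_zero: "0 \<in> adjoin_below A x d"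
  using adjoin_below_mono[of 0 d] by simp

lemma adjoin_below_minus:
  "p \<in> adjoin_below A x d \<Longrightarrow> q \<in> adjoin_below A x d \<Longrightarrow> p - q \<in> adjoin_below A x d"
proof (induction d arbitrary: p q)
  case (Suc d)
  from Suc.prems obtain a p' b q' where *: "p = a * x ^ d + p'" "q = b * x ^ d + q'"
    "a \<in> A" "b \<in> A" "p' \<in> adjoin_below A x d" "q' \<in> adjoin_below A x d"
    by auto
  then have "p - q = (a - b) * x ^ d + (p' - q')" by (simp add: algebra_simps)
  then show ?case
    using Suc.IH *(3-6) subring_closed(3)[OF A] adjoin_below_SucI by metis
qed simp

lemma adjoin_below_add:
  assumes "p \<in> adjoin_below A x d" "q \<in> adjoin_below A x d"
  shows "p + q \<in> adjoin_below A x d"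
  using adjoin_below_minus[OF assms(1) adjoin_below_minus[OF adjoin_below_zero assms(2)]] by simp

lemma adjoin_below_scale: "a \<in> A \<Longrightarrow> p \<in> adjoin_below A x d \<Longrightarrow> a * p \<in> adjoin_below A x d"
proof (induction d arbitrary: p)
  case (Suc d)
  from Suc.prems obtain b q where *: "p = b * x ^ d + q" "b \<in> A" "q \<in> adjoin_below A x d"
    by auto
  then have "a * p = (a * b) * x ^ d + a * q" by (simp add: algebra_simps)
  then show ?case
    using Suc.IH *(2,3) Suc.prems(1) subring_closed(5)[OF A] adjoin_below_SucI by metis
qed simp

lemma adjoin_below_power: "p \<in> adjoin_below A x d \<Longrightarrow> x ^ k * p \<in> adjoin_below A x (k + d)"
proof (induction d arbitrary: p)
  case 0
  then show ?case using adjoin_below_zero by simp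
next
  case (Suc d)
  from Suc.prems obtain b q where *: "p = b * x ^ d + q" "b \<in> A" "q \<in> adjoin_below A x d"
    by auto
  then have "x ^ k * p = b * x ^ (k + d) + x ^ k * q" by (simp add: algebra_simps power_add)
  then show ?case
    using Suc.IH[OF *(3)] *(2) adjoin_below_SucI by simp
qed

lemma adjoin_below_subset: "adjoin_below A x d \<subseteq> adjoin A x"
  by (auto simp: adjoin_def)

lemma adjoin_minus: "p \<in> adjoin A x \<Longrightarrow> q \<in> adjoin A x \<Longrightarrow> p - q \<in> adjoin A x"
proof -
  assume "p \<in> adjoin A x" "q \<in> adjoin A x"
  then obtain d e where "p \<in> adjoin_below A x d" "q \<in> adjoin_below A x e"
    by (auto simp: adjoin_def)
  then have "p \<in> adjoin_below A x (max d e)" "q \<in> adjoin_below A x (max d e)"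
    using adjoin_below_mono[of d "max d e"] adjoin_below_mono[of e "max d e"] by auto
  from adjoin_below_minus[OF this] show ?thesis using adjoin_below_subset by blast
qed

lemma base_subset_adjoin: "A \<subseteq> adjoin A x"
  using adjoin_below_SucI[of _ 0 0] adjoin_below_subset[of "Suc 0"] by fastforce

lemma adjoin_power: "x ^ k \<in> adjoin A x"
  using adjoin_below_SucI[OF subring_closed(1)[OF A] adjoin_below_zero[of k]] adjoin_below_subset
  by (metis add_0_right mult_1 subsetD)

lemma is_subring_adjoin: "is_subring (adjoin A x)"
  unfolding is_subring_def
proof (intro conjI ballI)
  show "1 \<in> adjoin A x" using base_subset_adjoin subring_closed(1)[OF A] by blast
  fix p q assume pq: "p \<in> adjoin A x" "q \<in> adjoin A x"
  then show "p - q \<in> adjoin A x" by (rule adjoin_minus)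
  have plus: "r + s \<in> adjoin A x" if "r \<in> adjoin A x" "s \<in> adjoin A x" for r s
    using adjoin_minus[OF that(1) adjoin_minus[OF _ that(2), of 0]] base_subset_adjoin
      subring_closed(2)[OF A] by auto
  have scale: "a * x ^ k * q \<in> adjoin A x" if "a \<in> A" for a k
    using pq(2) adjoin_below_scale[OF that adjoin_below_power, of q _ k]
    by (auto simp: adjoin_def mult.assoc)
  have "p \<in> adjoin_below A x d \<Longrightarrow> p * q \<in> adjoin A x" for d
  proof (induction d arbitrary: p)
    case 0
    then show ?case using adjoin_below_zero[of 0] adjoin_below_subset[of 0] by auto
  next
    case (Suc d)
    then show ?case using plus scale by (auto simp: distrib_right)
  qed
  with pq(1) show "p * q \<in> adjoin A x" by (auto simp: adjoin_def)
qed

text \<open>Hilbert's argument: the ideals of leading coefficients increase with the degree and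
  become stationary at some \<open>D\<close>. Lifting generators for each degree up to
  \<open>D\<close> gives finitely many elements of \<open>I\<close> with which the top term of any
  element of \<open>I\<close> can be cancelled.\<close>

theorem noetherian_adjoin:
  assumes "noetherian A"
  shows "noetherian (adjoin A x)"
  unfolding noetherian_def
proof (intro allI impI)
  let ?B = "adjoin A x" and ?R = "adjoin_below A x"
  note B = is_subring_adjoin
  fix I assume I: "is_ideal ?B I"
  have I_add: "p + q \<in> I" if "p \<in> I" "q \<in> I" for p q
    using that I by (auto simp: is_ideal_def)
  have I_mult: "b * p \<in> I" if "p \<in> I" "b \<in> ?B" for p b
    using that I by (auto simp: is_ideal_def)
  have I_zero: "0 \<in> I" and I_sub: "I \<subseteq> ?B" using I by (auto simp: is_ideal_def)
  have AB: "a \<in> ?B" if "a \<in> A" for a using that base_subset_adjoin by blast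
  \<comment> \<open>Coefficients at \<open>x ^ d\<close> of elements of \<open>I\<close> written
    with degree at most \<open>d\<close>; allowing the coefficient 0 makes \<open>L d\<close> an
    ideal.\<close>
  define L where "L d = {a \<in> A. \<exists>q\<in>?R d. a * x ^ d + q \<in> I}" for d
  have L_ideal: "is_ideal A (L d)" for d
    unfolding is_ideal_def
  proof (intro conjI ballI)
    show "L d \<subseteq> A" by (auto simp: L_def)
    show "0 \<in> L d" using I_zero adjoin_below_zero subring_closed(2)[OF A] by (force simp: L_def)
    fix a assume "a \<in> L d"
    then obtain q where a: "a \<in> A" "q \<in> ?R d" "a * x ^ d + q \<in> I" by (auto simp: L_def)
    {
      fix b assume "b \<in> L d"
      then obtain r where b: "b \<in> A" "r \<in> ?R d" "b * x ^ d + r \<in> I" by (auto simp: L_def)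
      have "(a + b) * x ^ d + (q + r) = (a * x ^ d + q) + (b * x ^ d + r)"
        by (simp add: algebra_simps)
      then have "(a + b) * x ^ d + (q + r) \<in> I" using I_add[OF a(3) b(3)] by (simp only:)
      then show "a + b \<in> L d"
        using subring_closed(4)[OF A a(1) b(1)] adjoin_below_add[OF a(2) b(2)] by (auto simp: L_def)
    }
    fix b assume b: "b \<in> A"
    have "b * a * x ^ d + b * q = b * (a * x ^ d + q)" by (simp add: algebra_simps)
    then have "b * a * x ^ d + b * q \<in> I" using I_mult[OF a(3) AB[OF b]] by (simp only:)
    then show "b * a \<in> L d"
      using subring_closed(5)[OF A b a(1)] adjoin_below_scale[OF b a(2)] by (auto simp: L_def)
  qed
  have L_mono: "L d \<subseteq> L e" if "d \<le> e" for d e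
  proof
    fix a assume "a \<in> L d"
    then obtain q where a: "a \<in> A" "q \<in> ?R d" "a * x ^ d + q \<in> I" by (auto simp: L_def)
    have "x ^ (e - d) * (a * x ^ d + q) \<in> I" using I_mult[OF a(3) adjoin_power] .
    moreover have "x ^ (e - d) * (a * x ^ d + q) = a * x ^ e + x ^ (e - d) * q"
      using that by (simp add: algebra_simps flip: power_add)
    ultimately show "a \<in> L e"
      using a(1) adjoin_below_power[OF a(2), of "e - d"] that by (auto simp: L_def)
  qed
  \<comment> \<open>Stationarity comes from finite generation: the union of the chain is an ideal,
    and one member contains its finitely many generators.\<close>
  obtain D where D: "L d \<subseteq> L D" for d
  proof -
    have "is_ideal A (\<Union>d. L d)"
      unfolding is_ideal_def
    proof (intro conjI ballI)
      fix a b assume "a \<in> (\<Union>d. L d)" "b \<in> (\<Union>d. L d)"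
      then obtain d e where "a \<in> L d" "b \<in> L e" by blast
      then have "a \<in> L (max d e)" "b \<in> L (max d e)"
        using L_mono[of d "max d e"] L_mono[of e "max d e"] by auto
      then show "a + b \<in> (\<Union>d. L d)" using L_ideal[of "max d e"] by (auto simp: is_ideal_def)
    next
      show "(\<Union>d. L d) \<subseteq> A" by (auto simp: L_def)
      have "0 \<in> L 0" using L_ideal[of 0] unfolding is_ideal_def by blast
      then show "0 \<in> (\<Union>d. L d)" by blast
      fix a b assume a: "a \<in> A" and "b \<in> (\<Union>d. L d)"
      then obtain d where "b \<in> L d" by blast
      with a L_ideal[of d] have "a * b \<in> L d" unfolding is_ideal_def by blast
      then show "a * b \<in> (\<Union>d. L d)" by blast
    qed
    with assms obtain C where C: "finite C" "C \<subseteq> (\<Union>d. L d)" "(\<Union>d. L d) \<subseteq> ideal_gen A C"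
      unfolding noetherian_def by blast
    have "\<exists>D. C \<subseteq> L D"
      using C(1,2)
    proof (induction C)
      case (insert c C)
      then obtain D e where "C \<subseteq> L D" "c \<in> L e" by auto
      then have "insert c C \<subseteq> L (max D e)"
        using L_mono[of D "max D e"] L_mono[of e "max D e"] by auto
      then show ?case ..
    qed simp
    then obtain D where "C \<subseteq> L D" ..
    with C(3) ideal_gen_subset[OF L_ideal] have "L d \<subseteq> L D" for d by blast
    with that show ?thesis by blast
  qed
  have "\<forall>d. \<exists>G. finite G \<and> G \<subseteq> L d \<and> L d \<subseteq> ideal_gen A G"
    using assms L_ideal unfolding noetherian_def by blast
  then obtain G where G: "\<And>d. finite (G d)" "\<And>d. G d \<subseteq> L d" "\<And>d. L d \<subseteq> ideal_gen A (G d)"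
    by metis
  have "\<forall>d. \<forall>c\<in>G d. \<exists>f. f \<in> I \<and> f - c * x ^ d \<in> ?R d"
  proof (intro allI ballI)
    fix d c assume "c \<in> G d"
    with G(2) obtain q where q: "q \<in> ?R d" "c * x ^ d + q \<in> I" by (auto simp: L_def)
    then show "\<exists>f. f \<in> I \<and> f - c * x ^ d \<in> ?R d" by (intro exI[of _ "c * x ^ d + q"]) simp
  qed
  then obtain f where f: "\<And>d c. c \<in> G d \<Longrightarrow> f d c \<in> I \<and> f d c - c * x ^ d \<in> ?R d"
    by metis
  define H where "H = (\<Union>d\<le>D. f d ` G d)"
  have H_sub: "H \<subseteq> I" using f by (auto simp: H_def)
  \<comment> \<open>A combination of the generators in \<open>G e\<close> is transported to the
    chosen elements of \<open>I\<close>, with error terms of smaller degree.\<close>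
  have lift: "\<exists>h\<in>ideal_gen ?B H. h - a * x ^ e \<in> ?R e" if "a \<in> ideal_gen A (G e)" "e \<le> D" for a e
    using that(1)
  proof induction
    case zero
    show ?case using ideal_gen.zero adjoin_below_zero by force
  next
    case (step r g a)
    then obtain h where h: "h \<in> ideal_gen ?B H" "h - a * x ^ e \<in> ?R e" by blast
    have "r * f e g + h \<in> ideal_gen ?B H"
      using step that(2) h(1) by (intro ideal_gen.step AB) (auto simp: H_def)
    moreover have "r * f e g + h - (r * g + a) * x ^ e = r * (f e g - g * x ^ e) + (h - a * x ^ e)"
      by (simp add: algebra_simps)
    moreover have "\<dots> \<in> ?R e"
      using f step by (intro adjoin_below_add adjoin_below_scale h(2)) auto
    ultimately show ?case by metis
  qed
  have gen: "p \<in> ?R d \<Longrightarrow> p \<in> I \<Longrightarrow> p \<in> ideal_gen ?B H" for p d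
  proof (induction d arbitrary: p)
    case 0
    then show ?case by (simp add: ideal_gen.zero)
  next
    case (Suc d)
    then obtain a q where p: "p = a * x ^ d + q" "a \<in> A" "q \<in> ?R d" by auto
    \<comment> \<open>Beyond \<open>D\<close> there are no new leading coefficients, so the elements
      lifted in degree \<open>D\<close> are used there, multiplied by a power of
      \<open>x\<close>.\<close>
    define e where "e = min d D"
    have e: "e \<le> d" "e \<le> D" by (auto simp: e_def)
    have "a \<in> L d" using p Suc.prems by (auto simp: L_def)
    then have "a \<in> L e" using D by (cases "d \<le> D") (auto simp: e_def min_def)
    then obtain h where h: "h \<in> ideal_gen ?B H" "h - a * x ^ e \<in> ?R e"
      using lift e(2) G(3) by blast
    let ?p = "p - x ^ (d - e) * h"
    have hI: "x ^ (d - e) * h \<in> ideal_gen ?B H" by (intro ideal_gen_mult B adjoin_power h(1))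
    then have "x ^ (d - e) * h \<in> I" using ideal_gen_subset[OF I H_sub] by blast
    from I_mult[OF this subring_closed(6)[OF B subring_closed(1)[OF B]]]
    have "?p \<in> I" using I_add[OF Suc.prems(2)] by fastforce
    \<comment> \<open>The top terms \<open>a * x ^ d\<close> cancel, and what is left has an
      expression of degree less than \<open>d\<close>.\<close>
    moreover have "?p = q - x ^ (d - e) * (h - a * x ^ e)"
      using e(1) by (simp add: p(1) algebra_simps flip: power_add)
    moreover have "\<dots> \<in> ?R d"
      using adjoin_below_power[OF h(2), of "d - e"] e(1) by (intro adjoin_below_minus p(3)) simp
    ultimately have "?p \<in> ideal_gen ?B H" by (intro Suc.IH) simp_all
    from ideal_gen_add[OF this hI] show ?case by simp
  qed
  have "finite H" using G(1) by (auto simp: H_def)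
  with H_sub gen I_sub show "\<exists>G. finite G \<and> G \<subseteq> I \<and> I \<subseteq> ideal_gen ?B G"
    by (intro exI[of _ H]) (auto simp: adjoin_def)
qed

end

lemma is_subring_polys_in: "is_subring (polys_in n :: 'a :: comm_ring_1 mpoly set)"
  unfolding is_subring_def by (auto intro: minus_in_polys_in mult_in_polys_in)

lemma var_power: "Poly_Mapping.single (Poly_Mapping.single n 1) 1 ^ k
    = (Poly_Mapping.single (Poly_Mapping.single n k) 1 :: 'a :: comm_semiring_1 mpoly)"
  by (induction k) (simp_all add: mult_single flip: single_add)

text \<open>Each monomial is a monomial in the smaller variables times a power of the variable with
  index \<open>n\<close>, and the adjunction is closed under sums.\<close>

lemma polys_in_Suc:
  "polys_in (Suc n) \<subseteq> adjoin (polys_in n) (Poly_Mapping.single (Poly_Mapping.single n 1) 1 :: 'a :: comm_ring_1 mpoly)"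
    (is "_ \<subseteq> adjoin ?A ?x")
proof
  note B = is_subring_adjoin[OF is_subring_polys_in, of n ?x]
  fix p :: "'a mpoly" assume p: "p \<in> polys_in (Suc n)"
  have monom: "Poly_Mapping.single m c \<in> adjoin ?A ?x" if m: "Poly_Mapping.keys m \<subseteq> {..<Suc n}" for m c
  proof -
    define m' where "m' = m - Poly_Mapping.single n (Poly_Mapping.lookup m n)"
    have lookup: "Poly_Mapping.lookup m' i = (if i = n then 0 else Poly_Mapping.lookup m i)" for i
      by (simp add: m'_def minus_poly_mapping.rep_eq lookup_single when_def)
    have "i \<in> {..<n}" if "i \<in> Poly_Mapping.keys m'" for i
    proof -
      from that have "i \<noteq> n" "i \<in> Poly_Mapping.keys m" by (auto simp: in_keys_iff lookup split: if_splits)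
      with m show ?thesis by fastforce
    qed
    then have "Poly_Mapping.keys m' \<subseteq> {..<n}" by (rule subsetI)
    then have "Poly_Mapping.single m' c \<in> adjoin ?A ?x"
      using single_in_polys_in base_subset_adjoin[OF is_subring_polys_in] by blast
    then have "Poly_Mapping.single m' c * ?x ^ k \<in> adjoin ?A ?x" for k
      by (intro subring_closed(5)[OF B] adjoin_power is_subring_polys_in)
    then have "Poly_Mapping.single (m' + Poly_Mapping.single n k) c \<in> adjoin ?A ?x" for k
      by (simp only: var_power mult_single mult_1_right)
    moreover have "m' + Poly_Mapping.single n (Poly_Mapping.lookup m n) = m"
      by (rule poly_mapping_eqI) (simp add: lookup lookup_add lookup_single when_def)
    ultimately show ?thesis by metis
  qed
  have "(\<Sum>m\<in>S. Poly_Mapping.single m (Poly_Mapping.lookup p m)) \<in> adjoin ?A ?x"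
    if "finite S" "S \<subseteq> Poly_Mapping.keys p" for S
    using that p subring_closed(2,4)[OF B] monom
    by (induction S) (auto simp: in_polys_in_iff)
  from this[of "Poly_Mapping.keys p"]
  have "(\<Sum>m\<in>Poly_Mapping.keys p. Poly_Mapping.single m (Poly_Mapping.lookup p m)) \<in> adjoin ?A ?x"
    by simp
  also have "(\<Sum>m\<in>Poly_Mapping.keys p. Poly_Mapping.single m (Poly_Mapping.lookup p m)) = p"
    by (rule poly_mapping_eqI) (simp add: lookup_sum lookup_single when_def in_keys_iff)
  finally show "p \<in> adjoin ?A ?x" .
qed

lemma adjoin_polys_in:
  "adjoin (polys_in n) (Poly_Mapping.single (Poly_Mapping.single n 1) 1) = (polys_in (Suc n) :: 'a :: comm_ring_1 mpoly set)"
    (is "adjoin ?A ?x = _")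
proof
  have le: "p \<in> polys_in (Suc n)" if "p \<in> polys_in n" for p :: "'a mpoly"
    using that by (fastforce simp: in_polys_in_iff)
  have "p \<in> polys_in (Suc n)" if "p \<in> adjoin_below ?A ?x d" for p d
    using that
  proof (induction d arbitrary: p)
    case (Suc d)
    moreover have "?x ^ d \<in> polys_in (Suc n)"
      by (intro power_in_polys_in single_in_polys_in) simp
    ultimately show ?case by (auto intro: add_in_polys_in mult_in_polys_in le)
  qed simp
  then show "adjoin ?A ?x \<subseteq> polys_in (Suc n)" by (auto simp: adjoin_def)
qed (rule polys_in_Suc)

text \<open>Variables are adjoined one at a time. In the base case the ring is a copy of the field,
  and any nonzero element generates it.\<close>

lemma noetherian_polys_in: "noetherian (polys_in n :: 'a :: field mpoly set)"
proof (induction n)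
  case 0
  have const: "\<exists>c. p = Poly_Mapping.single 0 c" if "p \<in> polys_in 0" for p :: "'a mpoly"
  proof
    show "p = Poly_Mapping.single 0 (Poly_Mapping.lookup p 0)"
      using that by (intro poly_mapping_eqI) (auto simp: in_polys_in_iff lookup_single when_def in_keys_iff)
  qed
  show ?case unfolding noetherian_def
  proof (intro allI impI)
    fix I :: "'a mpoly set" assume I: "is_ideal (polys_in 0) I"
    show "\<exists>G. finite G \<and> G \<subseteq> I \<and> I \<subseteq> ideal_gen (polys_in 0) G"
    proof (cases "I = {0}")
      case True
      then show ?thesis by (intro exI[of _ "{}"]) (simp add: ideal_gen.zero)
    next
      case False
      with I obtain p where p: "p \<in> I" "p \<noteq> 0" by (auto simp: is_ideal_def)
      with I const obtain c where c: "p = Poly_Mapping.single 0 c" by (auto simp: is_ideal_def)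
      with p have "c \<noteq> 0" by auto
      have "q \<in> ideal_gen (polys_in 0) {p}" if "q \<in> I" for q
      proof -
        from that I const obtain b where "q = Poly_Mapping.single 0 b" by (auto simp: is_ideal_def)
        with c \<open>c \<noteq> 0\<close> have "q = Poly_Mapping.single 0 (b / c) * p + 0" by (simp add: mult_single)
        then show ?thesis
          by (metis const_in_polys_in ideal_gen.step ideal_gen.zero singletonI)
      qed
      with p show ?thesis by (intro exI[of _ "{p}"]) auto
    qed
  qed
next
  case (Suc n)
  from noetherian_adjoin[OF is_subring_polys_in Suc] show ?case
    by (simp only: adjoin_polys_in[symmetric])
qed

section \<open>Dual families\<close>

definition scale_rat :: "rat \<Rightarrow> rat mpoly \<Rightarrow> rat mpoly" where
  "scale_rat c p = Poly_Mapping.single 0 c * p"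

lemma lookup_scale_rat [simp]: "Poly_Mapping.lookup (scale_rat c p) m = c * Poly_Mapping.lookup p m"
  by (simp add: scale_rat_def map.rep_eq when_def flip: mult_map_scale_conv_mult)

global_interpretation rpoly: vector_space scale_rat
  by unfold_locales (auto intro!: poly_mapping_eqI simp: lookup_add algebra_simps)

lemma poly_value_scale_rat [simp]: "poly_value v (scale_rat c p) = c * poly_value v p"
  by (simp add: scale_rat_def)

lemma complex_poly_scale_rat: "complex_poly (scale_rat c p) = scale_poly (of_rat c) (complex_poly p)"
  by (rule poly_mapping_eqI) (simp add: of_rat_mult)

lemma complex_poly_span:
  assumes "p \<in> rpoly.span S"
  shows "complex_poly p \<in> cpoly.span (complex_poly ` S)"
  using assms
proof (induction rule: rpoly.span_induct_alt)
  case base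
  then show ?case by (simp add: cpoly.span_zero)
next
  case (step c x y)
  then have "complex_poly x \<in> cpoly.span (complex_poly ` S)" by (intro cpoly.span_base imageI)
  with step show ?case
    unfolding complex_poly_add complex_poly_scale_rat by (intro cpoly.span_add cpoly.span_scale)
qed

text \<open>Gaussian elimination: the matrix \<open>\<phi> s (e t)\<close> is made the identity on \<open>T\<close>.\<close>

lemma dual_family:
  fixes \<phi> :: "'s \<Rightarrow> rat mpoly \<Rightarrow> rat"
  assumes "finite G"
    and add: "\<And>s p q. \<phi> s (p + q) = \<phi> s p + \<phi> s q"
    and scale: "\<And>s c p. \<phi> s (scale_rat c p) = c * \<phi> s p"
  shows "\<exists>T e. finite T \<and> T \<subseteq> S \<and> e ` T \<subseteq> rpoly.span G \<and>
    (\<forall>s\<in>T. \<forall>t\<in>T. \<phi> s (e t) = (if s = t then 1 else 0)) \<and>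
    (\<forall>g\<in>G. \<exists>w\<in>rpoly.span (e ` T). \<forall>s\<in>S. \<phi> s (g - w) = 0)"
  using assms(1)
proof induction
  case empty
  show ?case by (intro exI[of _ "{}"]) simp
next
  case (insert g G)
  have minus: "\<phi> s (p - q) = \<phi> s p - \<phi> s q" for s p q
    using add[of s "p - q" q] by simp
  have zero: "\<phi> s 0 = 0" for s using minus[of s 0 0] by simp
  have sum: "\<phi> s (sum f A) = (\<Sum>x\<in>A. \<phi> s (f x))" for s and f :: "'s \<Rightarrow> _" and A
    by (induction A rule: infinite_finite_induct) (simp_all add: zero add)
  from insert.IH obtain T e where T: "finite T" "T \<subseteq> S" "e ` T \<subseteq> rpoly.span G"
    and dual_all: "\<forall>s\<in>T. \<forall>t\<in>T. \<phi> s (e t) = (if s = t then 1 else 0)"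
    and res: "\<forall>g\<in>G. \<exists>w\<in>rpoly.span (e ` T). \<forall>s\<in>S. \<phi> s (g - w) = 0"
    by (elim exE conjE) (rule that)
  from dual_all have dual: "\<phi> s (e t) = (if s = t then 1 else 0)" if "s \<in> T" "t \<in> T" for s t
    using that by blast
  \<comment> \<open>By duality \<open>w\<close> takes the same values as \<open>g\<close> on
    \<open>T\<close>, so the residual \<open>r\<close> vanishes there.\<close>
  define w where "w = (\<Sum>t\<in>T. scale_rat (\<phi> t g) (e t))"
  define r where "r = g - w"
  have w: "w \<in> rpoly.span (e ` T)"
    unfolding w_def by (intro rpoly.span_sum rpoly.span_scale rpoly.span_base) auto
  have G_le: "rpoly.span G \<subseteq> rpoly.span (insert g G)" by (rule rpoly.span_mono) auto
  have r_T: "\<phi> t r = 0" if "t \<in> T" for t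
  proof -
    have "\<phi> t w = (\<Sum>s\<in>T. if s = t then \<phi> s g else 0)"
      unfolding w_def sum scale using dual that by (intro sum.cong) auto
    then show ?thesis using that T(1) by (simp add: r_def minus)
  qed
  show ?case
  proof (cases "\<forall>s\<in>S. \<phi> s r = 0")
    case True
    then have "\<exists>w\<in>rpoly.span (e ` T). \<forall>s\<in>S. \<phi> s (h - w) = 0" if "h \<in> insert g G" for h
      using that w res by (auto simp: r_def)
    then have "\<forall>h\<in>insert g G. \<exists>w\<in>rpoly.span (e ` T). \<forall>s\<in>S. \<phi> s (h - w) = 0" by (rule ballI)
    moreover have "e ` T \<subseteq> rpoly.span (insert g G)" using T(3) G_le by (rule subset_trans)
    ultimately show ?thesis
      using T(1,2) dual_all by (intro exI[of _ T] exI[of _ e] conjI)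
  next
    case False
    \<comment> \<open>The index \<open>s\<close> is a new pivot: \<open>r\<close> is scaled to the
      value 1 at \<open>s\<close>, and multiples of it clear the values of the old members at
      \<open>s\<close>. Their values on \<open>T\<close> stay the same because \<open>r\<close>
      vanishes on \<open>T\<close>. Each element of \<open>G\<close> adds at most one pivot, so
      \<open>T\<close> is finite even for infinite \<open>S\<close>.\<close>
    then obtain s where s: "s \<in> S" "\<phi> s r \<noteq> 0" by blast
    then have "s \<notin> T" using r_T by blast
    define n where "n = scale_rat (1 / \<phi> s r) r"
    define e' where "e' t = (if t = s then n else e t - scale_rat (\<phi> s (e t)) n)" for t
    have n_s: "\<phi> s n = 1" and n_T: "\<And>t. t \<in> T \<Longrightarrow> \<phi> t n = 0"
      using s(2) by (simp_all add: n_def scale r_T)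
    have r_n: "r = scale_rat (\<phi> s r) n"
      using s(2) by (simp add: n_def)
    have "w \<in> rpoly.span (insert g G)"
      using w rpoly.span_minimal[OF T(3) rpoly.subspace_span] G_le by blast
    moreover have "g \<in> rpoly.span (insert g G)" by (rule rpoly.span_base) simp
    ultimately have "r \<in> rpoly.span (insert g G)"
      unfolding r_def by (intro rpoly.span_diff)
    then have n_span: "n \<in> rpoly.span (insert g G)" unfolding n_def by (rule rpoly.span_scale)
    have e'_span: "e' ` insert s T \<subseteq> rpoly.span (insert g G)"
    proof
      fix p assume "p \<in> e' ` insert s T"
      then consider "p = n" | t where "t \<in> T" "p = e t - scale_rat (\<phi> s (e t)) n"
        by (auto simp: e'_def)
      then show "p \<in> rpoly.span (insert g G)"
      proof cases
        case 2
        then have "e t \<in> rpoly.span (insert g G)" using T(3) G_le by blast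
        with 2 n_span show ?thesis by (simp add: rpoly.span_diff rpoly.span_scale)
      qed (simp add: n_span)
    qed
    have dual': "\<phi> u (e' t) = (if u = t then 1 else 0)" if "u \<in> insert s T" "t \<in> insert s T" for u t
      using that \<open>s \<notin> T\<close> by (auto simp: e'_def n_s n_T minus scale dual)
    have n_e': "n \<in> rpoly.span (e' ` insert s T)"
      by (rule rpoly.span_base) (auto simp: e'_def)
    \<comment> \<open>The elimination step is invertible, hence the new span contains the old
      one.\<close>
    have "e t \<in> rpoly.span (e' ` insert s T)" if "t \<in> T" for t
    proof -
      have "e t = e' t + scale_rat (\<phi> s (e t)) n" using that \<open>s \<notin> T\<close> by (auto simp: e'_def)
      moreover have "e' t \<in> rpoly.span (e' ` insert s T)" using that by (intro rpoly.span_base) auto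
      ultimately show ?thesis using n_e' by (metis rpoly.span_add rpoly.span_scale)
    qed
    then have span_e: "rpoly.span (e ` T) \<subseteq> rpoly.span (e' ` insert s T)"
      by (intro rpoly.span_minimal) auto
    have res': "\<exists>w\<in>rpoly.span (e' ` insert s T). \<forall>s\<in>S. \<phi> s (h - w) = 0" if "h \<in> insert g G" for h
    proof (cases "h = g")
      case True
      have "r \<in> rpoly.span (e' ` insert s T)" by (subst r_n) (rule rpoly.span_scale[OF n_e'])
      with w span_e have "w + r \<in> rpoly.span (e' ` insert s T)" by (blast intro: rpoly.span_add)
      then show ?thesis using True by (intro bexI[of _ "w + r"]) (auto simp: r_def zero)
    next
      case False
      with that res span_e show ?thesis by blast
    qed
    have "finite (insert s T)" "insert s T \<subseteq> S" using T s by auto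
    with e'_span dual' res' show ?thesis
      by (intro exI[of _ "insert s T"] exI[of _ e'] conjI ballI)
  qed
qed

section \<open>Membership in spans and ideals witnessed by lists\<close>

lemma poly_of_lin_comb_terms_Cons:
  "poly_of_terms (lin_comb_terms (c # cs) ps) =
    scale_rat (fst c) (poly_of_terms (nth_default [] ps (snd c))) + poly_of_terms (lin_comb_terms cs ps)"
  by (simp add: lin_comb_terms_def comb_terms_def scale_rat_def)

lemma lin_comb_terms_span:
  "poly_of_terms (lin_comb_terms cs ps) \<in> rpoly.span (poly_of_terms ` set ps)"
proof (induction cs)
  case Nil
  then show ?case by (simp add: lin_comb_terms_def comb_terms_def rpoly.span_zero)
next
  case (Cons c cs)
  have "poly_of_terms (nth_default [] ps i) \<in> rpoly.span (poly_of_terms ` set ps)" for i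
    by (auto simp: nth_default_def rpoly.span_zero intro: rpoly.span_base)
  with Cons show ?case
    by (auto simp: poly_of_lin_comb_terms_Cons intro!: rpoly.span_add rpoly.span_scale)
qed

lemma span_lin_comb_terms:
  assumes "p \<in> rpoly.span (poly_of_terms ` set ps)"
  shows "\<exists>cs. p = poly_of_terms (lin_comb_terms cs ps)"
  using assms
proof (induction rule: rpoly.span_induct_alt)
  case base
  show ?case by (rule exI[of _ "[]"]) (simp add: lin_comb_terms_def comb_terms_def)
next
  case (step c x y)
  then obtain cs i where "y = poly_of_terms (lin_comb_terms cs ps)" "x = poly_of_terms (ps ! i)"
    "i < length ps" by (auto simp: in_set_conv_nth)
  then show ?case
    by (intro exI[of _ "(c, i) # cs"]) (simp add: poly_of_lin_comb_terms_Cons nth_default_nth)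
qed

lemma ideal_gen_comb_terms:
  assumes "p \<in> ideal_gen A (poly_of_terms ` set ps)"
  shows "\<exists>us. p = poly_of_terms (comb_terms us ps)"
  using assms
proof induction
  case zero
  show ?case by (rule exI[of _ "[]"]) (simp add: comb_terms_def)
next
  case (step r g p)
  then obtain us i where "p = poly_of_terms (comb_terms us ps)" "g = poly_of_terms (ps ! i)"
    "i < length ps" by (auto simp: in_set_conv_nth)
  moreover obtain t where "r = poly_of_terms t" using surj_poly_of_terms by blast
  ultimately show ?case
    by (intro exI[of _ "(t, i) # us"]) (simp add: comb_terms_def nth_default_nth)
qed

lemma poly_value_comb_terms:
  assumes "\<And>p. p \<in> set ps \<Longrightarrow> poly_value v (poly_of_terms p) = 0"
  shows "poly_value v (poly_of_terms (comb_terms us ps)) = 0"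
proof -
  have "poly_value v (poly_of_terms (nth_default [] ps i)) = 0" for i
    using assms by (auto simp: nth_default_def)
  then show ?thesis by (induction us) (simp_all add: comb_terms_def)
qed

section \<open>Reachable points\<close>

text \<open>The guard is tested at the point that is left, so a point where the loop stops still
  belongs to the set; an invariant has to vanish there too.\<close>

inductive_set reach :: "rat list \<Rightarrow> rat mpoly list \<Rightarrow> rat mpoly list list \<Rightarrow> rat list set" for a h F where
  init: "a \<in> reach a h F"
| step: "x \<in> reach a h F \<Longrightarrow> eval_poly (prod_list h) x \<noteq> 0 \<Longrightarrow> i < length F
    \<Longrightarrow> apply_map (F ! i) x \<in> reach a h F"

lemma run_Nil [simp]: "run F [] a = a"
  by (simp add: run_def)

lemma run_snoc [simp]: "run F (is @ [i]) a = apply_map (F ! i) (run F is a)"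
  by (simp add: run_def)

locale rational_loop =
  fixes a :: "rat list" and h :: "rat mpoly list" and F :: "rat mpoly list list"
  assumes h: "set h \<subseteq> polys_in (length a)"
    and F: "\<And>f. f \<in> set F \<Longrightarrow> length f = length a \<and> set f \<subseteq> polys_in (length a)"
begin

lemma apply_map_complex:
  assumes "i < length F" "length x = length a"
  shows "apply_map (map complex_poly (F ! i)) (map of_rat x) = map of_rat (apply_map (F ! i) x)"
    "length (apply_map (F ! i) x) = length a"
proof -
  have "length (F ! i) = length a" "set (F ! i) \<subseteq> polys_in (length a)"
    using F[of "F ! i"] assms(1) by auto
  then show "apply_map (map complex_poly (F ! i)) (map of_rat x) = map of_rat (apply_map (F ! i) x)"
    "length (apply_map (F ! i) x) = length a"
    using assms by (auto simp: apply_map_def intro!: eval_complex_poly)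
qed

lemma run_complex:
  assumes "set is \<subseteq> {..<length F}"
  shows "run (map (map complex_poly) F) is (map of_rat a) = map of_rat (run F is a)"
    "length (run F is a) = length a"
proof -
  have "run (map (map complex_poly) F) is (map of_rat a) = map of_rat (run F is a) \<and>
    length (run F is a) = length a"
    using assms by (induction "is" rule: rev_induct) (simp_all add: apply_map_complex)
  then show "run (map (map complex_poly) F) is (map of_rat a) = map of_rat (run F is a)"
    "length (run F is a) = length a" by auto
qed

lemma guard_complex:
  assumes "length x = length a"
  shows "eval_poly (prod_list (map complex_poly h)) (map of_rat x) = of_rat (eval_poly (prod_list h) x)"
  using assms h by (simp add: prod_list_in_polys_in eval_complex_poly flip: complex_poly_prod_list)

lemma reach_length: "x \<in> reach a h F \<Longrightarrow> length x = length a"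
  by (induction rule: reach.induct) (simp_all add: apply_map_complex)

lemma reach_run:
  assumes "set is \<subseteq> {..<length F}" "\<And>j. j < length is \<Longrightarrow> eval_poly (prod_list h) (run F (take j is) a) \<noteq> 0"
  shows "run F is a \<in> reach a h F"
  using assms
proof (induction "is" rule: rev_induct)
  case Nil
  show ?case by (simp add: reach.init)
next
  case (snoc i is')
  have "run F is' a \<in> reach a h F"
  proof (rule snoc.IH)
    fix j assume "j < length is'"
    then show "eval_poly (prod_list h) (run F (take j is') a) \<noteq> 0"
      using snoc.prems(2)[of j] by simp
  qed (use snoc.prems(1) in auto)
  moreover have "eval_poly (prod_list h) (run F is' a) \<noteq> 0"
    using snoc.prems(2)[of "length is'"] by simp
  ultimately show ?case using snoc.prems(1) by (simp add: reach.step)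
qed

lemma reach_obtain_run:
  assumes "x \<in> reach a h F"
  obtains "is" where "set is \<subseteq> {..<length F}" "x = run F is a"
    "\<And>j. j < length is \<Longrightarrow> eval_poly (prod_list h) (run F (take j is) a) \<noteq> 0"
proof -
  have "\<exists>is. set is \<subseteq> {..<length F} \<and> x = run F is a \<and>
    (\<forall>j<length is. eval_poly (prod_list h) (run F (take j is) a) \<noteq> 0)"
    using assms
  proof induction
    case init
    show ?case by (rule exI[of _ "[]"]) simp
  next
    case (step x i)
    then obtain is' where "set is' \<subseteq> {..<length F}" "x = run F is' a"
      "\<forall>j<length is'. eval_poly (prod_list h) (run F (take j is') a) \<noteq> 0"
      by blast
    with step.hyps show ?case by (intro exI[of _ "is' @ [i]"]) (auto simp: less_Suc_eq)
  qed
  with that show ?thesis by blast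
qed

text \<open>The alternative with \<open>l'\<close> excuses exactly the points behind the first zero
  of the guard, and these are the ones that a word does not reach legally. The polynomial
  \<open>g\<close> is complex, but its values matter at rational points only.\<close>

lemma loop_invariant_iff:
  assumes "g \<in> polys_in (length a)"
  shows "loop_invariant (map of_rat a) (map complex_poly h) (map (map complex_poly) F) g \<longleftrightarrow>
    (\<forall>x\<in>reach a h F. eval_poly g (map of_rat x) = 0)"
    (is "?inv \<longleftrightarrow> _")
proof
  let ?r = "\<lambda>is. run (map (map complex_poly) F) is (map of_rat a)"
  have run: "?r is = map of_rat (run F is a)"
    and guard: "eval_poly (prod_list (map complex_poly h)) (?r is) = of_rat (eval_poly (prod_list h) (run F is a))"
    if "set is \<subseteq> {..<length F}" for "is"
    using that run_complex[OF that] by (simp_all add: guard_complex)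
  have take: "set (take j is) \<subseteq> {..<length F}" if "set is \<subseteq> {..<length F}" for j "is"
    using that set_take_subset[of j "is"] by blast
  {
    assume inv: ?inv
    show "\<forall>x\<in>reach a h F. eval_poly g (map of_rat x) = 0"
    proof
      fix x assume "x \<in> reach a h F"
      then obtain "is" where "is": "set is \<subseteq> {..<length F}" "x = run F is a"
        and valid: "\<And>j. j < length is \<Longrightarrow> eval_poly (prod_list h) (run F (take j is) a) \<noteq> 0"
        by (rule reach_obtain_run) (rule that)
      show "eval_poly g (map of_rat x) = 0"
      proof (cases "is = []")
        \<comment> \<open>For the empty word the range of \<open>j\<close> is empty, so the initial
          point is governed by the separate clause on \<open>a\<close>.\<close>
        case True
        with inv "is"(2) show ?thesis by (simp add: loop_invariant_def)
      next
        case False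
        \<comment> \<open>The guard is nonzero before every step of a legal word, which rules out
          the alternative with \<open>l'\<close>.\<close>
        have "eval_poly (prod_list (map complex_poly h)) (?r (take j is)) \<noteq> 0" if "j < length is" for j
          using valid[OF that] guard[OF take[OF "is"(1)]] by simp
        with inv "is"(1) have "\<forall>j\<in>{1..length is}. eval_poly g (?r (take j is)) = 0"
          unfolding loop_invariant_def length_map by blast
        with False have "eval_poly g (?r is) = 0"
          by (auto dest!: bspec[of _ _ "length is"] simp: Suc_le_eq)
        with run[OF "is"(1)] "is"(2) show ?thesis by simp
      qed
    qed
  }
  assume reach: "\<forall>x\<in>reach a h F. eval_poly g (map of_rat x) = 0"
  show ?inv
    unfolding loop_invariant_def length_map
  proof (intro conjI allI impI)
    show "g \<in> polys_in (length a)" by fact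
    show "eval_poly g (map of_rat a) = 0" using reach reach.init by blast
    fix "is" :: "nat list" assume "is": "set is \<subseteq> {..<length F}"
    let ?stop = "\<lambda>j. j < length is \<and> eval_poly (prod_list h) (run F (take j is) a) = 0"
    have zero: "eval_poly g (?r (take j is)) = 0" if "\<And>i. i < j \<Longrightarrow> \<not> ?stop i" "j \<le> length is" for j
    proof -
      have "run F (take j is) a \<in> reach a h F"
      proof (rule reach_run[OF take[OF "is"]])
        fix i assume "i < length (take j is)"
        then have "i < j" "i < length is" by auto
        with that(1)[of i] show "eval_poly (prod_list h) (run F (take i (take j is)) a) \<noteq> 0"
          by (simp add: min_def)
      qed
      with reach run[OF take[OF "is"]] show ?thesis by simp
    qed
    show "(\<forall>j\<in>{1..length is}. eval_poly g (?r (take j is)) = 0) \<or>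
      (\<exists>l'<length is. (\<forall>j\<in>{1..l'}. eval_poly g (?r (take j is)) = 0) \<and>
         eval_poly (prod_list (map complex_poly h)) (?r (take l' is)) = 0)"
    proof (cases "\<exists>l. ?stop l")
      case True
      \<comment> \<open>The least stopping index serves as \<open>l'\<close>: every prefix of length
        at most \<open>l\<close> is legal, including the one at which the loop stops.\<close>
      then obtain l where "?stop l" and least: "\<And>i. i < l \<Longrightarrow> \<not> ?stop i"
        using exists_least_iff[of ?stop] by blast
      then have l: "l < length is" "eval_poly (prod_list (map complex_poly h)) (?r (take l is)) = 0"
        using guard[OF take[OF "is"]] by auto
      have "eval_poly g (?r (take j is)) = 0" if "j \<in> {1..l}" for j
        using that least l(1) by (intro zero) auto
      with l show ?thesis by blast
    next
      case False
      then show ?thesis using zero by auto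
    qed
  qed
qed

lemma eval_reach:
  assumes "x \<in> reach a h F" "p \<in> polys_in (length a)"
  shows "eval_poly p x = poly_value (nth_default 0 x) p"
  using assms by (simp add: eval_poly_nth_default reach_length)

lemma eval_complex_reach:
  assumes "x \<in> reach a h F" "p \<in> polys_in (length a)"
  shows "eval_poly p (map of_rat x) = poly_value (\<lambda>i. of_rat (nth_default 0 x i) :: complex) p"
proof -
  have "eval_poly p (map of_rat x) = poly_value (nth_default 0 (map of_rat x)) p"
    using assms by (simp add: eval_poly_nth_default reach_length)
  also have "nth_default 0 (map of_rat x) = (\<lambda>i. of_rat (nth_default 0 x i) :: complex)"
    by (auto simp: nth_default_def)
  finally show ?thesis .
qed

end

section \<open>Certificates\<close>

definition apply_terms :: "terms list \<Rightarrow> rat list \<Rightarrow> rat list" where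
  "apply_terms f x = map (\<lambda>p. eval_terms p x) f"

text \<open>The boolean records whether the word has been legal so far. The point is updated in any
  case, by the empty map if the index is out of range, which keeps the function total.\<close>

definition walk :: "terms list \<Rightarrow> terms list list \<Rightarrow> rat list \<Rightarrow> nat list \<Rightarrow> bool \<times> rat list" where
  "walk h F a w = fold (\<lambda>i s. (fst s \<and> i < length F \<and> eval_terms (prod_terms h) (snd s) \<noteq> 0,
      apply_terms (nth_default [] F i) (snd s))) w (True, a)"

text \<open>The \<open>es\<close> are dual to the reachable points visited by the words \<open>ws\<close>, so they contribute
  nothing to an invariant; the \<open>bs\<close> are dual to the coefficient functionals \<open>ms\<close>, hence independent.
  The ideal generated by \<open>bs @ qs\<close> is inductive: it vanishes at \<open>a\<close>, and the loop body preserves it.\<close>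

definition certified :: "rat list \<Rightarrow> terms list \<Rightarrow> terms list \<Rightarrow> terms list list \<Rightarrow> terms list \<Rightarrow> bool" where
  "certified a g h F bs \<longleftrightarrow> (\<exists>(ms :: nat list list) (es :: terms list) (ws :: nat list list) (qs :: terms list).
     (\<forall>b\<in>set (bs @ es). \<exists>cs. eq_terms b (lin_comb_terms cs g)) \<and>
     (\<forall>p\<in>set g. \<exists>cs. eq_terms p (lin_comb_terms cs (bs @ es))) \<and>
     (\<forall>i<length bs. \<forall>j<length bs.
        coeff_terms (nth_default [] bs i) (nth_default [] ms j) = (if i = j then 1 else 0)) \<and>
     (\<forall>i<length es. \<forall>j<length es. fst (walk h F a (nth_default [] ws j)) \<and>
        eval_terms (nth_default [] es i) (snd (walk h F a (nth_default [] ws j))) = (if i = j then 1 else 0)) \<and>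
     (\<forall>q\<in>set (bs @ qs). eval_terms q a = 0 \<and>
        (\<forall>f\<in>set F. \<exists>us. eq_terms (mul_terms (prod_terms h) (subst_terms q f)) (comb_terms us (bs @ qs)))))"

lemma computable_apply_terms [computable_intros]:
  "computable f \<Longrightarrow> computable g \<Longrightarrow> computable (\<lambda>x. apply_terms (f x) (g x))"
  by (rule computable_lift2) (unfold apply_terms_def, intro computable_intros)

lemma computable_walk [computable_intros]:
  assumes "computable h" "computable F" "computable a" "computable w"
  shows "computable (\<lambda>x. walk (h x) (F x) (a x) (w x))"
  unfolding walk_def
  by (intro computable_intros assms computable_comp[OF assms(1)] computable_comp[OF assms(2)])

text \<open>The projections unpack the inputs \<open>(a, g, h, F)\<close> and the output
  \<open>bs\<close>. Everything quantified existentially, including \<open>cs\<close> and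
  \<open>us\<close>, becomes part of the search.\<close>

lemma semidecidable_certified:
  "semidecidable (\<lambda>z. certified (fst (fst z)) (fst (snd (fst z))) (fst (snd (snd (fst z))))
      (snd (snd (snd (fst z)))) (snd z))"
  unfolding certified_def
  by (intro semidecidable_intros computable_intros semidecidable_computable)

lemma apply_terms_conv_apply_map:
  assumes "set (map poly_of_terms f) \<subseteq> polys_in (length x)"
  shows "apply_terms f x = apply_map (map poly_of_terms f) x"
  using assms by (auto simp: apply_terms_def apply_map_def eval_terms eval_poly_nth_default)

text \<open>Both sides agree beyond the length of \<open>f\<close> as well: a missing component is
  the zero polynomial on the left and a padded 0 on the right.\<close>

lemma eval_terms_subst:
  "poly_value (nth_default 0 x) (poly_of_terms (subst_terms q f)) = eval_terms q (apply_terms f x)"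
proof -
  have "(\<lambda>i. poly_value (nth_default 0 x) (poly_of_terms (nth_default [] f i)))
      = nth_default 0 (apply_terms f x)"
    by (auto simp: fun_eq_iff nth_default_def apply_terms_def eval_terms)
  then show ?thesis by (simp add: poly_value_subst_terms eval_terms)
qed

locale coded_loop = rational_loop a "map poly_of_terms h" "map (map poly_of_terms) F"
  for a :: "rat list" and h :: "terms list" and F :: "terms list list"
begin

abbreviation "R \<equiv> reach a (map poly_of_terms h) (map (map poly_of_terms) F)"

lemma guard_terms:
  "x \<in> R \<Longrightarrow> eval_terms (prod_terms h) x = eval_poly (prod_list (map poly_of_terms h)) x"
  using h by (simp add: eval_reach eval_terms prod_list_in_polys_in)

lemma apply_terms_conv:
  assumes "x \<in> R" "f \<in> set F"
  shows "apply_terms f x = apply_map (map poly_of_terms f) x"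
  using assms F[of "map poly_of_terms f"] by (intro apply_terms_conv_apply_map) (simp add: reach_length)

lemma reach_stepI:
  assumes "x \<in> R" "f \<in> set F" "eval_terms (prod_terms h) x \<noteq> 0"
  shows "apply_terms f x \<in> R"
proof -
  obtain i where "i < length F" "f = F ! i" using assms(2) by (auto simp: in_set_conv_nth)
  with assms show ?thesis
    using reach.step[of x a "map poly_of_terms h" "map (map poly_of_terms) F" i]
    by (simp add: guard_terms apply_terms_conv)
qed

lemma walk_snoc: "walk h F a (w @ [i]) =
    (fst (walk h F a w) \<and> i < length F \<and> eval_terms (prod_terms h) (snd (walk h F a w)) \<noteq> 0,
     apply_terms (nth_default [] F i) (snd (walk h F a w)))"
  by (simp add: walk_def)

lemma walk_reach: "fst (walk h F a w) \<Longrightarrow> snd (walk h F a w) \<in> R"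
proof (induction w rule: rev_induct)
  case Nil
  show ?case by (simp add: walk_def reach.init)
next
  case (snoc i w)
  then show ?case by (auto simp: walk_snoc nth_default_nth intro: reach_stepI)
qed

lemma reach_walk: "x \<in> R \<Longrightarrow> \<exists>w. walk h F a w = (True, x)"
proof (induction rule: reach.induct)
  case init
  show ?case by (rule exI[of _ "[]"]) (simp add: walk_def)
next
  case (step x i)
  then obtain w where w: "walk h F a w = (True, x)" by blast
  from step have "walk h F a (w @ [i]) = (True, apply_map (map (map poly_of_terms) F ! i) x)"
    by (simp add: walk_snoc w nth_default_nth guard_terms apply_terms_conv)
  then show ?case ..
qed

text \<open>All members of \<open>qs\<close> are treated at once in the induction over reachable
  points, because the composite of one member with a map is a combination of all of them, up to the
  guard factor, which is nonzero at the point that is left.\<close>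

lemma inductive_vanish:
  assumes init: "\<And>q. q \<in> set qs \<Longrightarrow> eval_terms q a = 0"
    and step: "\<And>q f. q \<in> set qs \<Longrightarrow> f \<in> set F \<Longrightarrow>
      \<exists>us. eq_terms (mul_terms (prod_terms h) (subst_terms q f)) (comb_terms us qs)"
    and "x \<in> R" "q \<in> set qs"
  shows "eval_terms q x = 0"
  using assms(3,4)
proof (induction arbitrary: q rule: reach.induct)
  case init
  then show ?case by (rule assms(1))
next
  case (step x i)
  let ?v = "poly_value (nth_default 0 x)"
  have f: "F ! i \<in> set F" using step.hyps by simp
  obtain us where us: "poly_of_terms (mul_terms (prod_terms h) (subst_terms q (F ! i)))
      = poly_of_terms (comb_terms us qs)"
    using assms(2)[OF step.prems f] by (auto simp: eq_terms_iff)
  have "?v (poly_of_terms (comb_terms us qs)) = 0"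
    using step.IH by (intro poly_value_comb_terms) (simp add: eval_terms)
  then have "?v (poly_of_terms (prod_terms h)) * ?v (poly_of_terms (subst_terms q (F ! i))) = 0"
    unfolding us[symmetric] by simp
  moreover have "?v (poly_of_terms (prod_terms h)) \<noteq> 0"
    using step.hyps guard_terms[of x] by (simp add: eval_terms)
  ultimately show ?case
    using step.hyps f by (simp add: eval_terms_subst apply_terms_conv)
qed

end

section \<open>Soundness and completeness of certificates\<close>

lemma cpoly_span_image:
  assumes "v \<in> cpoly.span (f ` {..<k :: nat})"
  shows "\<exists>\<beta>. v = (\<Sum>i<k. scale_poly (\<beta> i) (f i))"
  using assms
proof (induction rule: cpoly.span_induct_alt)
  case base
  show ?case by (rule exI[of _ "\<lambda>_. 0"]) simp
next
  case (step c x y)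
  then obtain \<beta> j where *: "y = (\<Sum>i<k. scale_poly (\<beta> i) (f i))" "x = f j" "j < k" by blast
  have "(\<Sum>i<k. scale_poly ((\<beta>(j := \<beta> j + c)) i) (f i))
      = (\<Sum>i<k. scale_poly (\<beta> i) (f i) + (if i = j then scale_poly c (f j) else 0))"
    by (intro sum.cong) (auto simp: cpoly.scale_left_distrib)
  also have "\<dots> = y + scale_poly c x" using * by (simp add: sum.distrib)
  finally show ?case by (intro exI[of _ "\<beta>(j := \<beta> j + c)"]) (simp add: add.commute)
qed

lemma poly_value_scale_poly [simp]: "poly_value v (scale_poly c p) = c * poly_value v p"
proof -
  have "scale_poly c p = Poly_Mapping.single 0 c * p"
    by (simp add: scale_poly_def mult_map_scale_conv_mult)
  then show ?thesis by simp
qed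

lemma subspace_polys_in: "cpoly.subspace (polys_in n)"
proof (rule cpoly.subspaceI)
  show "scale_poly c p \<in> polys_in n" if "p \<in> polys_in n" for c p
    using that by (auto simp: in_polys_in_iff in_keys_iff)
qed (auto intro: add_in_polys_in)

lemma rpoly_subspace_polys_in: "rpoly.subspace (polys_in n)"
proof (rule rpoly.subspaceI)
  show "scale_rat c p \<in> polys_in n" if "p \<in> polys_in n" for c p
    using that by (auto simp: in_polys_in_iff in_keys_iff)
qed (auto intro: add_in_polys_in)

context coded_loop
begin

lemma certified_sound:
  assumes g: "poly_of_terms ` set g \<subseteq> polys_in (length a)"
    and cert: "certified a g h F bs"
  shows "is_vector_basis (map complex_poly (map poly_of_terms bs))
    (truncated_ideal (map of_rat a) (map complex_poly (map poly_of_terms h))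
      (map (map complex_poly) (map (map poly_of_terms) F))
      (cpoly.span (set (map complex_poly (map poly_of_terms g)))))"
proof -
  let ?c = "\<lambda>t. complex_poly (poly_of_terms t)"
  from cert obtain ms es ws qs where
    in_span: "\<forall>b\<in>set (bs @ es). \<exists>cs. eq_terms b (lin_comb_terms cs g)" and
    generate: "\<forall>p\<in>set g. \<exists>cs. eq_terms p (lin_comb_terms cs (bs @ es))" and
    dual_b: "\<forall>i<length bs. \<forall>j<length bs.
        coeff_terms (nth_default [] bs i) (nth_default [] ms j) = (if i = j then 1 else 0)" and
    dual_e: "\<forall>i<length es. \<forall>j<length es. fst (walk h F a (nth_default [] ws j)) \<and>
        eval_terms (nth_default [] es i) (snd (walk h F a (nth_default [] ws j))) = (if i = j then 1 else 0)" and
    ind: "\<forall>q\<in>set (bs @ qs). eval_terms q a = 0 \<and>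
        (\<forall>f\<in>set F. \<exists>us. eq_terms (mul_terms (prod_terms h) (subst_terms q f)) (comb_terms us (bs @ qs)))"
    unfolding certified_def by (elim exE conjE) (rule that)
  define E where "E = cpoly.span (set (map complex_poly (map poly_of_terms g)))"
  define V where "V = truncated_ideal (map of_rat a) (map complex_poly (map poly_of_terms h))
      (map (map complex_poly) (map (map poly_of_terms) F)) E"
  \<comment> \<open>Complex polynomials are evaluated at rational points padded by zeros. On
    \<open>E\<close> this agrees with the evaluation used in the definition of an invariant.\<close>
  let ?v = "\<lambda>x. poly_value (\<lambda>i. of_rat (nth_default 0 x i)) :: complex mpoly \<Rightarrow> complex"
  have E_in: "E \<subseteq> polys_in (length a)"
    unfolding E_def using g by (intro cpoly.span_minimal subspace_polys_in) auto
  have V_iff: "p \<in> V \<longleftrightarrow> p \<in> E \<and> (\<forall>x\<in>R. ?v x p = 0)" for p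
  proof (cases "p \<in> E")
    case True
    with E_in have p: "p \<in> polys_in (length a)" by blast
    with True show ?thesis
      by (simp add: V_def truncated_ideal_def loop_invariant_iff eval_complex_reach del: map_map)
  qed (simp add: V_def truncated_ideal_def)
  have val: "?v x (?c t) = of_rat (eval_terms t x)" for x t
    by (simp add: poly_value_complex_poly eval_terms)
  have V_subspace: "cpoly.subspace V"
    by (rule cpoly.subspaceI)
      (auto simp: V_iff E_def intro: cpoly.span_zero cpoly.span_add cpoly.span_scale)
  \<comment> \<open>Taken alone, \<open>bs\<close> may not generate an inductive ideal;
    \<open>qs\<close> supplies the remaining generators.\<close>
  have b_vanish: "eval_terms b x = 0" if "x \<in> R" "b \<in> set bs" for x b
    by (rule inductive_vanish[of "bs @ qs"]) (use ind that in auto)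
  have bs_E: "?c b \<in> E" if "b \<in> set (bs @ es)" for b
  proof -
    from in_span that obtain cs where "poly_of_terms b = poly_of_terms (lin_comb_terms cs g)"
      by (auto simp: eq_terms_iff)
    then have "poly_of_terms b \<in> rpoly.span (poly_of_terms ` set g)"
      using lin_comb_terms_span[of cs g] by simp
    from complex_poly_span[OF this] show ?thesis by (simp add: E_def image_image)
  qed
  have bs_V: "?c ` set bs \<subseteq> V"
    using bs_E b_vanish by (auto simp: V_iff val)
  have E_le: "E \<subseteq> cpoly.span (?c ` set bs \<union> ?c ` set es)"
    unfolding E_def
  proof (intro cpoly.span_minimal cpoly.subspace_span subsetI)
    fix p assume "p \<in> set (map complex_poly (map poly_of_terms g))"
    then obtain t where t: "t \<in> set g" "p = ?c t" by auto
    with generate obtain cs where "poly_of_terms t = poly_of_terms (lin_comb_terms cs (bs @ es))"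
      by (auto simp: eq_terms_iff)
    then have "poly_of_terms t \<in> rpoly.span (poly_of_terms ` set (bs @ es))"
      using lin_comb_terms_span[of cs "bs @ es"] by simp
    from complex_poly_span[OF this] show "p \<in> cpoly.span (?c ` set bs \<union> ?c ` set es)"
      by (simp add: t(2) image_image image_Un)
  qed
  have "V \<subseteq> cpoly.span (?c ` set bs)"
  proof
    fix p assume p: "p \<in> V"
    with E_le have "p \<in> cpoly.span (?c ` set bs \<union> ?c ` set es)" by (auto simp: V_iff)
    then obtain b e where be: "p = b + e" "b \<in> cpoly.span (?c ` set bs)" "e \<in> cpoly.span (?c ` set es)"
      by (auto simp: cpoly.span_Un)
    have "?c ` set es = (\<lambda>i. ?c (es ! i)) ` {..<length es}"
      by (auto simp: set_conv_nth)
    with be(3) have "e \<in> cpoly.span ((\<lambda>i. ?c (es ! i)) ` {..<length es})" by simp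
    from cpoly_span_image[OF this]
    obtain \<beta> where \<beta>: "e = (\<Sum>i<length es. scale_poly (\<beta> i) (?c (es ! i)))" ..
    \<comment> \<open>Both \<open>p\<close> and \<open>b\<close> are invariants, so \<open>e\<close>
      vanishes on \<open>R\<close>; its value at the point dual to \<open>es ! j\<close> is
      \<open>\<beta> j\<close>.\<close>
    have b_V: "b \<in> V" using be(2) cpoly.span_minimal[OF bs_V V_subspace] by blast
    have "\<beta> j = 0" if j: "j < length es" for j
    proof -
      let ?x = "snd (walk h F a (nth_default [] ws j))"
      have x: "?x \<in> R" using dual_e j by (intro walk_reach) blast
      have "?v ?x e = 0" using p b_V x by (simp add: V_iff be(1))
      moreover have "?v ?x e = (\<Sum>i<length es. if i = j then \<beta> i else 0)"
        unfolding \<beta> poly_value_sum poly_value_scale_poly val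
        using dual_e j by (intro sum.cong) (auto simp: nth_default_nth)
      ultimately show ?thesis using j by simp
    qed
    then have "e = 0" unfolding \<beta> by simp
    with be show "p \<in> cpoly.span (?c ` set bs)" by simp
  qed
  moreover have "cpoly.span (?c ` set bs) \<subseteq> V" by (rule cpoly.span_minimal[OF bs_V V_subspace])
  ultimately have span: "cpoly.span (?c ` set bs) = V" by (rule subset_antisym[rotated])
  let ?m = "\<lambda>j. Poly_Mapping.nth (nth_default [] ms j) :: nat \<Rightarrow>\<^sub>0 nat"
  have coeff: "Poly_Mapping.lookup (?c (bs ! i)) (?m j) = (if i = j then 1 else 0)"
    if "i < length bs" "j < length bs" for i j
    using dual_b that by (simp add: coeff_terms nth_default_nth)
  have "distinct (map ?c bs)"
    unfolding distinct_conv_nth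
  proof (intro allI impI)
    fix i j assume ij: "i < length (map ?c bs)" "j < length (map ?c bs)" "i \<noteq> j"
    then have "Poly_Mapping.lookup (?c (bs ! i)) (?m j) \<noteq> Poly_Mapping.lookup (?c (bs ! j)) (?m j)"
      using coeff by (simp del: lookup_complex_poly)
    then have "?c (bs ! i) \<noteq> ?c (bs ! j)" by (rule contrapos_nn) (rule arg_cong)
    with ij show "map ?c bs ! i \<noteq> map ?c bs ! j" by simp
  qed
  moreover have "cpoly.independent (?c ` set bs)"
    unfolding cpoly.dependent_def
  proof
    assume "\<exists>p\<in>?c ` set bs. p \<in> cpoly.span (?c ` set bs - {p})"
    then obtain j where j: "j < length bs" "?c (bs ! j) \<in> cpoly.span (?c ` set bs - {?c (bs ! j)})"
      by (auto simp: in_set_conv_nth)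
    \<comment> \<open>The coefficient at \<open>?m j\<close> vanishes on the span of the other
      members but equals 1 at \<open>bs ! j\<close>.\<close>
    have "cpoly.span (?c ` set bs - {?c (bs ! j)}) \<subseteq> {p. Poly_Mapping.lookup p (?m j) = 0}"
    proof (intro cpoly.span_minimal cpoly.subspaceI)
      show "?c ` set bs - {?c (bs ! j)} \<subseteq> {p. Poly_Mapping.lookup p (?m j) = 0}"
      proof
        fix p assume p: "p \<in> ?c ` set bs - {?c (bs ! j)}"
        then obtain i where i: "i < length bs" "p = ?c (bs ! i)" by (auto simp: in_set_conv_nth)
        with p have "i \<noteq> j" by blast
        with i show "p \<in> {p. Poly_Mapping.lookup p (?m j) = 0}" using coeff j(1) by simp
      qed
    qed (auto simp: lookup_add)
    with j coeff show False by auto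
  qed
  ultimately have "is_vector_basis (map complex_poly (map poly_of_terms bs)) V"
    using span by (simp add: is_vector_basis_def image_image o_def)
  then show ?thesis unfolding V_def E_def .
qed

lemma certified_complete:
  assumes g: "poly_of_terms ` set g \<subseteq> polys_in (length a)"
  shows "\<exists>bs. certified a g h F bs"
proof -
  let ?P = "poly_of_terms" and ?A = "polys_in (length a) :: rat mpoly set"
  let ?v = "\<lambda>x. poly_value (nth_default 0 x) :: rat mpoly \<Rightarrow> rat"
  let ?G = "?P ` set g"
  define rep where "rep p = (SOME t. p = ?P t)" for p
  have rep: "?P (rep p) = p" for p
    unfolding rep_def using someI_ex[OF surj_poly_of_terms[of p]] by simp
  \<comment> \<open>Elimination with the evaluations at reachable points: on all of
    \<open>R\<close>, each generator of \<open>E\<close> agrees with a combination of the finitely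
    many functions dual to \<open>T\<close>.\<close>
  obtain T e where T: "finite T" "T \<subseteq> R" "e ` T \<subseteq> rpoly.span ?G"
    and dual_e: "\<forall>s\<in>T. \<forall>t\<in>T. ?v s (e t) = (if s = t then 1 else 0)"
    and res_e: "\<forall>p\<in>?G. \<exists>w\<in>rpoly.span (e ` T). \<forall>s\<in>R. ?v s (p - w) = 0"
  proof -
    have "finite ?G" by simp
    from dual_family[OF this, of ?v R, OF poly_value_add poly_value_scale_rat] show thesis
      by (elim exE conjE) (rule that)
  qed
  from bchoice[OF res_e[unfolded Bex_def]] obtain w where
    "\<forall>p\<in>?G. w p \<in> rpoly.span (e ` T) \<and> (\<forall>x\<in>R. ?v x (p - w p) = 0)" ..
  then have w: "w p \<in> rpoly.span (e ` T)" and vanish: "\<forall>x\<in>R. ?v x (p - w p) = 0"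
    if "p \<in> ?G" for p
    using that by blast+
  \<comment> \<open>The residuals vanish on \<open>R\<close> and span the rational invariants: if a
    combination of the generators vanishes on \<open>R\<close>, then so does the same combination of
    the \<open>w p\<close>, which is 0 by duality.\<close>
  define K where "K = (\<lambda>p. p - w p) ` ?G"
  \<comment> \<open>The residuals may be linearly dependent. Elimination with all coefficient
    functionals extracts a basis, since a polynomial on which all of them vanish is 0.\<close>
  obtain M b where M: "finite M" "b ` M \<subseteq> rpoly.span K"
    and dual_b: "\<forall>m\<in>M. \<forall>m'\<in>M. Poly_Mapping.lookup (b m') m = (if m = m' then 1 else 0)"
    and res_b: "\<forall>p\<in>K. \<exists>w\<in>rpoly.span (b ` M). \<forall>m\<in>UNIV. Poly_Mapping.lookup (p - w) m = 0"
  proof -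
    have "finite K" by (simp add: K_def)
    from dual_family[OF this, of "\<lambda>m p. Poly_Mapping.lookup p m" UNIV, OF lookup_add lookup_scale_rat]
    show thesis by (elim exE conjE) (rule that)
  qed
  obtain tl ml where tl: "set tl = T" "distinct tl" and ml: "set ml = M" "distinct ml"
    using T(1) M(1) by (metis finite_distinct_list)
  define word where "word x = (SOME w. walk h F a w = (True, x))" for x
  have word: "walk h F a (word x) = (True, x)" if "x \<in> R" for x
    unfolding word_def by (rule someI_ex[OF reach_walk[OF that]])
  define exps where "exps m = (SOME d. m = Poly_Mapping.nth d)" for m :: "nat \<Rightarrow>\<^sub>0 nat"
  have exps: "Poly_Mapping.nth (exps m) = m" for m
  proof -
    have "\<exists>d. m = Poly_Mapping.nth d"
      using surj_decode_monomial unfolding decode_monomial_def surj_def by blast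
    from someI_ex[OF this] show ?thesis unfolding exps_def by simp
  qed
  define bs where "bs = map (\<lambda>m. rep (b m)) ml"
  define es where "es = map (\<lambda>x. rep (e x)) tl"
  have set_bs: "?P ` set bs = b ` M" and set_es: "?P ` set es = e ` T"
    by (simp_all add: bs_def es_def rep image_image ml tl)
  have K_span: "K \<subseteq> rpoly.span ?G"
  proof
    fix k assume "k \<in> K"
    then obtain p where p: "p \<in> ?G" "k = p - w p" by (auto simp: K_def)
    have "w p \<in> rpoly.span ?G"
      using w[OF p(1)] rpoly.span_minimal[OF T(3) rpoly.subspace_span] by blast
    then show "k \<in> rpoly.span ?G" unfolding p(2) by (intro rpoly.span_diff rpoly.span_base[OF p(1)])
  qed
  then have KG: "rpoly.span K \<subseteq> rpoly.span ?G" by (intro rpoly.span_minimal rpoly.subspace_span)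
  have GA: "rpoly.span ?G \<subseteq> ?A" using g by (intro rpoly.span_minimal rpoly_subspace_polys_in)
  \<comment> \<open>The vanishing ideal of \<open>R\<close> in the ring with exactly as many
    variables as the dimension, where Hilbert's theorem applies.\<close>
  define J where "J = {p \<in> ?A. \<forall>x\<in>R. ?v x p = 0}"
  have J_ideal: "is_ideal ?A J"
    unfolding is_ideal_def J_def by (auto intro: add_in_polys_in mult_in_polys_in)
  have "rpoly.subspace {p. \<forall>x\<in>R. ?v x p = 0}" by (rule rpoly.subspaceI) auto
  moreover have "K \<subseteq> {p. \<forall>x\<in>R. ?v x p = 0}" using vanish unfolding K_def by blast
  ultimately have "rpoly.span K \<subseteq> {p. \<forall>x\<in>R. ?v x p = 0}" by (intro rpoly.span_minimal)
  with KG GA M(2) have bJ: "b ` M \<subseteq> J" unfolding J_def by blast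
  obtain Q where Q: "finite Q" "Q \<subseteq> J" "J \<subseteq> ideal_gen ?A Q"
    using noetherian_polys_in[of "length a", where 'a = rat] J_ideal unfolding noetherian_def by blast
  obtain ql where ql: "set ql = Q" using Q(1) finite_list by blast
  define qs where "qs = map rep ql"
  have set_qs: "?P ` set qs = Q" by (simp add: qs_def rep image_image ql)
  have in_span: "\<exists>cs. eq_terms p (lin_comb_terms cs g)" if "p \<in> set (bs @ es)" for p
  proof -
    have "?P p \<in> b ` M \<union> e ` T" using that set_bs set_es by auto
    then have "?P p \<in> rpoly.span ?G" using M(2) KG T(3) by blast
    then show ?thesis unfolding eq_terms_iff by (rule span_lin_comb_terms)
  qed
  have generate: "\<exists>cs. eq_terms p (lin_comb_terms cs (bs @ es))" if "p \<in> set g" for p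
  proof -
    have p: "?P p \<in> ?G" using that by blast
    then have "?P p - w (?P p) \<in> K" by (simp add: K_def)
    with res_b obtain u where u: "u \<in> rpoly.span (b ` M)"
      "\<forall>m\<in>UNIV. Poly_Mapping.lookup (?P p - w (?P p) - u) m = 0" by blast
    then have "?P p - w (?P p) - u = 0" by (intro poly_mapping_eqI) simp
    then have "?P p = u + w (?P p)" by (simp add: algebra_simps)
    also have "\<dots> \<in> rpoly.span (?P ` set (bs @ es))"
      using u(1) w[OF p] rpoly.span_mono[of "b ` M" "?P ` set (bs @ es)"]
        rpoly.span_mono[of "e ` T" "?P ` set (bs @ es)"]
      by (intro rpoly.span_add) (auto simp: set_bs set_es image_Un)
    finally show ?thesis unfolding eq_terms_iff by (rule span_lin_comb_terms)
  qed
  have coeff: "coeff_terms (nth_default [] bs i) (nth_default [] (map exps ml) j) = (if i = j then 1 else 0)"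
    if "i < length bs" "j < length bs" for i j
  proof -
    have "ml ! i \<in> M" "ml ! j \<in> M" "ml ! i = ml ! j \<longleftrightarrow> i = j"
      using that ml by (auto simp: bs_def nth_eq_iff_index_eq)
    with dual_b that show ?thesis by (auto simp: bs_def nth_default_nth coeff_terms rep exps)
  qed
  have points: "fst (walk h F a (nth_default [] (map word tl) j)) \<and>
      eval_terms (nth_default [] es i) (snd (walk h F a (nth_default [] (map word tl) j))) = (if i = j then 1 else 0)"
    if "i < length es" "j < length es" for i j
  proof -
    have "tl ! i \<in> T" "tl ! j \<in> T" "tl ! i = tl ! j \<longleftrightarrow> i = j"
      using that tl by (auto simp: es_def nth_eq_iff_index_eq)
    moreover from this have "walk h F a (word (tl ! j)) = (True, tl ! j)" using T(2) word by blast
    ultimately show ?thesis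
      using dual_e that by (auto simp: es_def nth_default_nth eval_terms rep)
  qed
  have ind: "eval_terms q a = 0 \<and>
      (\<forall>f\<in>set F. \<exists>us. eq_terms (mul_terms (prod_terms h) (subst_terms q f)) (comb_terms us (bs @ qs)))"
    if "q \<in> set (bs @ qs)" for q
  proof (intro conjI ballI)
    have "?P q \<in> b ` M \<union> Q" using that set_bs set_qs by auto
    then have q: "?P q \<in> J" using bJ Q(2) by blast
    then show "eval_terms q a = 0" by (simp add: J_def eval_terms reach.init)
    fix f assume f: "f \<in> set F"
    then have f_in: "set (map ?P f) \<subseteq> ?A" using F[of "map ?P f"] by auto
    have "?P (mul_terms (prod_terms h) (subst_terms q f)) \<in> J"
      unfolding J_def
    proof (intro CollectI conjI ballI)
      show "?P (mul_terms (prod_terms h) (subst_terms q f)) \<in> ?A"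
        unfolding poly_of_mul_terms poly_of_prod_terms
        using f_in h by (intro mult_in_polys_in prod_list_in_polys_in subst_terms_in_polys_in) auto
      fix x assume x: "x \<in> R"
      have "eval_terms (prod_terms h) x * eval_terms q (apply_terms f x) = 0"
      proof (cases "eval_terms (prod_terms h) x = 0")
        \<comment> \<open>A nonzero guard makes the successor reachable, where \<open>q\<close>
          vanishes; otherwise the guard factor already makes the product 0.\<close>
        case False
        from reach_stepI[OF x f this] q show ?thesis by (simp add: J_def eval_terms)
      qed simp
      then show "?v x (?P (mul_terms (prod_terms h) (subst_terms q f))) = 0"
        unfolding poly_of_mul_terms poly_value_mult eval_terms_subst by (simp only: eval_terms)
    qed
    with Q(3) have "?P (mul_terms (prod_terms h) (subst_terms q f)) \<in> ideal_gen ?A Q" by blast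
    then have "?P (mul_terms (prod_terms h) (subst_terms q f)) \<in> ideal_gen ?A (?P ` set (bs @ qs))"
      by induction (auto simp: set_qs image_Un intro: ideal_gen.intros)
    then show "\<exists>us. eq_terms (mul_terms (prod_terms h) (subst_terms q f)) (comb_terms us (bs @ qs))"
      unfolding eq_terms_iff by (rule ideal_gen_comb_terms)
  qed
  have "certified a g h F bs"
    unfolding certified_def
    by (rule exI[of _ "map exps ml"], rule exI[of _ es], rule exI[of _ "map word tl"],
      rule exI[of _ qs], intro conjI, rule ballI, erule in_span, rule ballI, erule generate,
      intro allI impI, erule (1) coeff, intro allI impI, erule (1) points, rule ballI, erule ind)
  then show ?thesis ..
qed

end

theorem theorem4p21:
  shows "\<exists>TruncatedIdealBranch :: recf.
    \<forall>(n :: nat) (a :: rat list) (g :: rat mpoly list) (h :: rat mpoly list)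
      (F :: rat mpoly list list) ca cg ch cF.
      length a = n \<and> set g \<subseteq> polys_in n \<and> set h \<subseteq> polys_in n \<and>
      (\<forall>f\<in>set F. length f = n \<and> set f \<subseteq> polys_in n) \<and>
      decode_list decode_rat ca = a \<and>
      decode_list decode_poly cg = g \<and>
      decode_list decode_poly ch = h \<and>
      decode_list (decode_list decode_poly) cF = F \<longrightarrow>
      (\<exists>out. rec_eval TruncatedIdealBranch [ca, cg, ch, cF] out \<and>
         is_vector_basis (map complex_poly (decode_list decode_poly out))
           (truncated_ideal (map of_rat a) (map complex_poly h) (map (map complex_poly) F)
              (cpoly.span (set (map complex_poly g)))))"
proof -
  have decode_polys: "decode_list decode_poly c = map poly_of_terms (dec c)" for c
    by (rule decode_list_conv_dec) (rule decode_poly_conv_dec)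
  have decode_maps: "decode_list (decode_list decode_poly) c = map (map poly_of_terms) (dec c)" for c
    by (rule decode_list_conv_dec) (rule decode_polys)
  have decode_point: "decode_list decode_rat c = dec c" for c
    by (simp add: dec_list_def dec_rat_def[abs_def])
  note decode = decode_polys decode_maps decode_point
  \<comment> \<open>The search expects one code, so the four inputs are paired in the nesting used
    by \<open>dec\<close> for tuples; \<open>?pair\<close> below computes this number.\<close>
  let ?input = "\<lambda>ca cg ch cF. prod_encode (ca, prod_encode (cg, prod_encode (ch, cF)))"
  obtain r where r: "\<And>c. (\<exists>bs. (\<lambda>z. certified (fst (fst z)) (fst (snd (fst z))) (fst (snd (snd (fst z))))
      (snd (snd (snd (fst z)))) (snd z)) (dec c, bs)) \<Longrightarrow>
      \<exists>out. rec_eval r [c] out \<and> (\<lambda>z. certified (fst (fst z)) (fst (snd (fst z))) (fst (snd (snd (fst z))))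
        (snd (snd (snd (fst z)))) (snd z)) (dec c, dec out)"
    using semidecidable_uniformize[OF semidecidable_certified] by blast
  obtain p where p: "\<And>x y. rec_eval p [x, y] (prod_encode (x, y))"
    using recursive2_prod_encode unfolding recursive2_def by blast
  let ?pair = "Comp p [Proj 0, Comp p [Proj 1, Comp p [Proj 2, Proj 3]]]"
  have pair: "rec_eval ?pair [ca, cg, ch, cF] (?input ca cg ch cF)" for ca cg ch cF
    by (intro rec_eval_Comp2[OF _ _ p])
      (use rec_eval.Proj[of 0 "[ca, cg, ch, cF]"] rec_eval.Proj[of 1 "[ca, cg, ch, cF]"]
        rec_eval.Proj[of 2 "[ca, cg, ch, cF]"] rec_eval.Proj[of 3 "[ca, cg, ch, cF]"]
        in \<open>simp_all add: numeral_2_eq_2 numeral_3_eq_3\<close>)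
  show ?thesis
  proof (intro exI[of _ "Comp r [?pair]"] allI impI)
    fix n and a :: "rat list" and g h :: "rat mpoly list" and F :: "rat mpoly list list"
      and ca cg ch cF
    assume *: "length a = n \<and> set g \<subseteq> polys_in n \<and> set h \<subseteq> polys_in n \<and>
      (\<forall>f\<in>set F. length f = n \<and> set f \<subseteq> polys_in n) \<and>
      decode_list decode_rat ca = a \<and>
      decode_list decode_poly cg = g \<and>
      decode_list decode_poly ch = h \<and>
      decode_list (decode_list decode_poly) cF = F"
    \<comment> \<open>The certificate refers to the term lists stored in the codes, so the loop is
      interpreted for these representatives of the polynomials.\<close>
    define g' h' F' where "g' = (dec cg :: terms list)" and "h' = (dec ch :: terms list)"
      and "F' = (dec cF :: terms list list)"
    have dec: "a = dec ca" "g = map poly_of_terms g'" "h = map poly_of_terms h'"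
      "F = map (map poly_of_terms) F'"
      using * by (auto simp: decode g'_def h'_def F'_def)
    interpret coded_loop a h' F'
    proof
      show "set (map poly_of_terms h') \<subseteq> polys_in (length a)" using * by (simp add: dec(3))
      fix f assume "f \<in> set (map (map poly_of_terms) F')"
      with * show "length f = length a \<and> set f \<subseteq> polys_in (length a)"
        unfolding dec(4)[symmetric] by blast
    qed
    have g': "poly_of_terms ` set g' \<subseteq> polys_in (length a)" using * by (simp add: dec)
    from certified_complete[OF g'] obtain bs where "certified a g' h' F' bs" ..
    with r[of "?input ca cg ch cF"] obtain out where
      out: "rec_eval r [?input ca cg ch cF] out" "certified a g' h' F' (dec out)"
      by (auto simp: dec(1) g'_def h'_def F'_def)
    from certified_sound[OF g' out(2)] rec_eval_Comp1[OF pair out(1)]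
    show "\<exists>out. rec_eval (Comp r [?pair]) [ca, cg, ch, cF] out \<and>
         is_vector_basis (map complex_poly (decode_list decode_poly out))
           (truncated_ideal (map of_rat a) (map complex_poly h) (map (map complex_poly) F)
              (cpoly.span (set (map complex_poly g))))"
      by (intro exI[of _ out]) (simp only: dec(2-4) decode)
  qed
qed

end
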